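(* Let $n\ge p\ge 2$, let $\mathbf{X}\in\mathbb{R}^{n\times p}$ be a Gaussian random matrix with mean $\mathbf{M}$ and mutually independent rows with positive definite covariance matrix $\boldsymbol{\Sigma}\in\mathbb{R}^{p\times p}$, and assume $\tilde{\mathbf{m}}_1\neq\mathbf{0}$. Let $\rho=w_{11\cdot 2}/\sigma_{11\cdot 2}$ be the scaled scalar Schur complement in $\mathbf{W}=\mathbf{X}'\mathbf{X}$, with $u$, $\lambda$, $\nu$ as defined in the context, and let $h$ be the p.d.f. of $u$ on $[0,1]$. Let $M_\rho(\theta)=\mathbb{E}[e^{\theta\rho}]$ be the moment-generating function of $\rho$, and let $G_B(s)=\sum_{k=0}^\infty s^k\beta_k$ be the probability-generating function of the mixture weights $$\beta_k=\frac{(\lambda/2)^k}{k!}\int_0^1 u^k e^{-\lambda u/2}h(u)\,du,\qquad k=0,1,2,\ldots.$$ Then, regardless of $h$, for all $\theta<1/2$, $$M_\rho(\theta)=(1-2\theta)^{-\nu/2}\,G_B\!\left(\frac{1}{1-2\theta}\right).$$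
   Context: Partition into first column and remaining columns: $\mathbf{X}=(\mathbf{x}_1\ \mathbf{X}_2)$, $\mathbf{M}=(\mathbf{m}_1\ \mathbf{M}_2)$, with $\mathbf{x}_1,\mathbf{m}_1\in\mathbb{R}^n$ and $\mathbf{X}_2,\mathbf{M}_2\in\mathbb{R}^{n\times(p-1)}$, and $$\boldsymbol{\Sigma}=\begin{pmatrix}\sigma_{11}&\boldsymbol{\sigma}_{21}'\\ \boldsymbol{\sigma}_{21}&\boldsymbol{\Sigma}_{22}\end{pmatrix},\qquad \sigma_{11\cdot 2}=\sigma_{11}-\boldsymbol{\sigma}_{21}'\boldsymbol{\Sigma}_{22}^{-1}\boldsymbol{\sigma}_{21}.$$ A prime denotes transpose. With $\mathbf{W}=\mathbf{X}'\mathbf{X}=\begin{pmatrix}w_{11}&\mathbf{w}_{21}'\\ \mathbf{w}_{21}&\mathbf{W}_{22}\end{pmatrix}$ partitioned analogously, the scalar Schur complement of $\mathbf{W}_{22}$ in $\mathbf{W}$ is $$w_{11\cdot 2}=w_{11}-\mathbf{w}_{21}'\mathbf{W}_{22}^{-1}\mathbf{w}_{21}=\mathbf{x}_1'\mathbf{Q}_2\mathbf{x}_1,\qquad \mathbf{Q}_2=\mathbf{I}_n-\mathbf{X}_2(\mathbf{X}_2'\mathbf{X}_2)^{-1}\mathbf{X}_2'.$$ Define $$\tilde{\mathbf{m}}_1=\mathbf{m}_1-\mathbf{M}_2\boldsymbol{\Sigma}_{22}^{-1}\boldsymbol{\sigma}_{21},\quad u=\frac{\tilde{\mathbf{m}}_1'\mathbf{Q}_2\tilde{\mathbf{m}}_1}{\|\tilde{\mathbf{m}}_1\|^2}\in[0,1],\quad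 \lambda=\frac{\|\tilde{\mathbf{m}}_1\|^2}{\sigma_{11\cdot 2}},\quad \nu=n-p+1.$$ The numbers $\beta_k$ are the weights in the representation of the p.d.f. of $\rho$ as a mixture $\sum_{k\ge0}\beta_k g_{\nu+2k}(w)$ of central chi-square p.d.f.s $g_m(w)=\frac{1}{2^{m/2}\Gamma(m/2)}w^{m/2-1}e^{-w/2}$, $w>0$; they are viewed as the probabilities $\Pr(B=k)$ of a nonnegative integer-valued random variable $B$. *)

theory Defs
  imports "HOL-Probability.Probability"
begin

text \<open>
  An n by p matrix with p \<ge> 2 has type \<open>real^('q option)^'n\<close>, where n is \<open>CARD('n)\<close> and
  p is \<open>CARD('q option) = CARD('q) + 1\<close>.  The column index \<open>None\<close> plays the role of 1 and the
  indices \<open>Some j\<close> those of 2, ..., p.  Since \<open>'q\<close> is nonempty, p \<ge> 2 holds automatically.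
\<close>

definition first_col :: "real^('q::finite option)^'n \<Rightarrow> real^'n" where
  "first_col A = column None A"

definition rest_cols :: "real^('q::finite option)^'n \<Rightarrow> real^'q^'n" where
  "rest_cols A = (\<chi> i j. A $ i $ Some j)"

definition block21 :: "real^('q::finite option)^('q option) \<Rightarrow> real^'q" where
  "block21 A = (\<chi> j. A $ Some j $ None)"

definition block22 :: "real^('q::finite option)^('q option) \<Rightarrow> real^'q^'q" where
  "block22 A = (\<chi> i j. A $ Some i $ Some j)"

text \<open>
  The upper right block is taken to be the transpose of the lower left one, so this is meant for
  symmetric matrices.  For random arguments below, the block being inverted is singular only on a
  null set, where \<open>matrix_inv\<close> has an arbitrary constant value.
\<close>

definition schur_compl :: "real^('q::finite option)^('q option) \<Rightarrow> real" where
  "schur_compl A = A $ None $ None - block21 A \<bullet> (matrix_inv (block22 A) *v block21 A)"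

definition positive_definite :: "real^'p^'p \<Rightarrow> bool" where
  "positive_definite A \<longleftrightarrow> transpose A = A \<and> (\<forall>x. x \<noteq> 0 \<longrightarrow> x \<bullet> (A *v x) > 0)"

definition mv_normal_density :: "real^'p \<Rightarrow> real^'p^'p \<Rightarrow> real^'p \<Rightarrow> real" where
  "mv_normal_density \<mu> \<Sigma> y =
     exp (- ((y - \<mu>) \<bullet> (matrix_inv \<Sigma> *v (y - \<mu>))) / 2) / sqrt ((2 * pi) ^ CARD('p) * det \<Sigma>)"

text \<open>
  Mutually independent rows, row i being normal with mean the i-th row of the mean matrix and
  covariance \<open>\<Sigma>\<close>.  The density formulation presupposes that \<open>\<Sigma>\<close> is positive definite.
\<close>

definition gaussian_matrix ::
  "'a measure \<Rightarrow> ('a \<Rightarrow> real^'p^'n) \<Rightarrow> real^'p^'n \<Rightarrow> real^'p^'p \<Rightarrow> bool" where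
  "gaussian_matrix P X M \<Sigma> \<longleftrightarrow>
     prob_space.indep_vars P (\<lambda>_. borel) (\<lambda>i \<omega>. X \<omega> $ i) UNIV \<and>
     (\<forall>i. distributed P lborel (\<lambda>\<omega>. X \<omega> $ i) (\<lambda>y. ennreal (mv_normal_density (M $ i) \<Sigma> y)))"

definition Q2 :: "real^('q::finite option)^'n \<Rightarrow> real^'n^'n" where
  "Q2 X = mat 1 - rest_cols X ** matrix_inv (transpose (rest_cols X) ** rest_cols X)
                    ** transpose (rest_cols X)"

definition m_tilde ::
  "real^('q::finite option)^'n \<Rightarrow> real^('q option)^('q option) \<Rightarrow> real^'n" where
  "m_tilde M \<Sigma> = first_col M - rest_cols M *v (matrix_inv (block22 \<Sigma>) *v block21 \<Sigma>)"

definition u_ratio ::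
  "real^('q::finite option)^'n \<Rightarrow> real^('q option)^('q option) \<Rightarrow> real^('q option)^'n \<Rightarrow> real" where
  "u_ratio M \<Sigma> X = (m_tilde M \<Sigma> \<bullet> (Q2 X *v m_tilde M \<Sigma>)) / (norm (m_tilde M \<Sigma>))\<^sup>2"

definition noncentrality ::
  "real^('q::finite option)^'n \<Rightarrow> real^('q option)^('q option) \<Rightarrow> real" where
  "noncentrality M \<Sigma> = (norm (m_tilde M \<Sigma>))\<^sup>2 / schur_compl \<Sigma>"

definition rho :: "real^('q::finite option)^('q option) \<Rightarrow> real^('q option)^'n \<Rightarrow> real" where
  "rho \<Sigma> X = schur_compl (transpose X ** X) / schur_compl \<Sigma>"

text \<open>
  The density \<open>h\<close> lives on [0,1]; its values elsewhere are irrelevant.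
\<close>

definition pdf_on_unit :: "'a measure \<Rightarrow> ('a \<Rightarrow> real) \<Rightarrow> (real \<Rightarrow> real) \<Rightarrow> bool" where
  "pdf_on_unit P U h \<longleftrightarrow> (\<forall>x\<in>{0..1}. 0 \<le> h x) \<and>
     distributed P lborel U (\<lambda>x. ennreal (indicator {0..1} x * h x))"

definition mix_weight :: "real \<Rightarrow> (real \<Rightarrow> real) \<Rightarrow> nat \<Rightarrow> real" where
  "mix_weight l h k =
     (l / 2) ^ k / fact k * (LINT u:{0..1}|lborel. u ^ k * exp (- l * u / 2) * h u)"

definition mgf :: "'a measure \<Rightarrow> ('a \<Rightarrow> real) \<Rightarrow> real \<Rightarrow> real" where
  "mgf P Y \<theta> = (LINT \<omega>|P. exp (\<theta> * Y \<omega>))"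

definition pgf :: "(nat \<Rightarrow> real) \<Rightarrow> real \<Rightarrow> real" where
  "pgf b s = (\<Sum>k. s ^ k * b k)"

end

theory Submission
  imports Defs
begin

text \<open>
  Condition on the columns \<open>R\<close> of \<open>X\<close> other than the first.  With
  \<open>b = regression_coeffs \<Sigma>\<close> (the vector \<open>\<Sigma>\<^sub>2\<^sub>2\<^sup>-\<^sup>1 \<sigma>\<^sub>2\<^sub>1\<close>), \<open>m = m_tilde M \<Sigma>\<close> and \<open>\<sigma> = schur_compl \<Sigma>\<close>, the
  first column is then normal with mean \<open>R b + m\<close> and covariance \<open>\<sigma> I\<close>, so \<open>y = x - R b\<close> is normal with
  mean \<open>m\<close> and covariance \<open>\<sigma> I\<close>.  The matrix \<open>Q\<close> called \<open>Q2\<close> is the orthogonal projection onto the complement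
  of the range of \<open>R\<close>; it annihilates \<open>R b\<close>, and so \<open>\<rho> = (y \<bullet> Q y) / \<sigma>\<close>.  The projection has rank
  \<open>n - (p - 1) = \<nu>\<close>, because \<open>R\<close> has full column rank almost surely.

  Given \<open>R\<close>, the exponential moment of \<open>\<rho>\<close> comes from completing the square.  With
  \<open>c = sqrt (1 - 2 \<theta>)\<close>, the exponent \<open>\<theta> (y \<bullet> Q y) / \<sigma> - |y - m|\<^sup>2 / (2 \<sigma>)\<close> equals a constant
  \<open>\<theta> / (1 - 2 \<theta>) (m \<bullet> Q m) / \<sigma>\<close> minus \<open>|S y - m'|\<^sup>2 / (2 \<sigma>)\<close>, where \<open>S\<close> multiplies by \<open>c\<close> on the image of
  \<open>Q\<close> and is the identity on its kernel.  The Jacobian of \<open>S\<close> is \<open>c\<^sup>\<nu>\<close>, and \<open>(m \<bullet> Q m) / \<sigma> = \<lambda> u\<close>.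
  Averaging over \<open>R\<close> gives
  \<open>E exp (\<theta> \<rho>) = (1 - 2 \<theta>)\<^bsup>-\<nu>/2\<^esup> E exp (\<theta> / (1 - 2 \<theta>) \<lambda> u)\<close>, which is
  \<open>mgf_rho_eq_exp_moment_u_ratio\<close>.  The conditional moment depends on \<open>R\<close> through \<open>u\<close> alone,
  which is why the final formula has the same shape for every density \<open>h\<close>.

  On the other side put \<open>s = 1 / (1 - 2 \<theta>)\<close>, so that \<open>(s - 1) / 2 = \<theta> / (1 - 2 \<theta>)\<close>.  Summing
  \<open>s\<^sup>k (\<lambda>/2)\<^sup>k u\<^sup>k e\<^bsup>-\<lambda>u/2\<^esup> / k!\<close> under the integral against \<open>h\<close> yields
  \<open>E exp ((s - 1) \<lambda> u / 2)\<close>, the same exponential moment of \<open>u\<close> (\<open>exponential_moment_sums\<close>).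

  All measures are handled through densities with respect to Lebesgue measure, and conditioning becomes
  Tonelli's theorem on \<open>\<real>\<^sup>n \<times> \<real>\<^bsup>n \<times> (p - 1)\<^esup>\<close>; \<open>gaussian_matrix_nn_integral\<close> is this disintegration.
  The supporting facts are the factorization of the row density by the block inverse
  (\<open>inverse_quadratic_form\<close>), the Jacobian of \<open>S\<close> (\<open>nn_integral_lborel_dilation\<close>) and the
  almost sure full rank of \<open>R\<close> (\<open>null_set_rank_deficient\<close>).
\<close>

section \<open>Lebesgue measure: coordinates and linear substitutions\<close>

lemma measurable_vecI:
  fixes f :: "'a \<Rightarrow> 'b::euclidean_space^'n"
  assumes "\<And>i. (\<lambda>x. f x $ i) \<in> borel_measurable M"
  shows "f \<in> borel_measurable M"
proof (subst borel_measurable_euclidean_space, intro ballI)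
  fix b :: "'b^'n" assume "b \<in> Basis"
  then obtain i u where "b = axis i u" unfolding Basis_vec_def by auto
  then show "(\<lambda>x. f x \<bullet> b) \<in> borel_measurable M"
    using assms by (simp add: inner_axis)
qed

lemma measurable_vec_lambda:
  "vec_lambda \<in> borel_measurable (PiM UNIV (\<lambda>_::'n::finite. borel :: 'a::euclidean_space measure))"
  by (rule measurable_vecI) simp

lemma measurable_vec_nth [measurable]: "(\<lambda>x::'b::euclidean_space^'n. x $ i) \<in> borel_measurable borel"
  by (intro borel_measurable_continuous_onI continuous_intros)

lemma mem_box_vec:
  fixes x :: "'a::euclidean_space^'n"
  shows "x \<in> box l u \<longleftrightarrow> (\<forall>i. x $ i \<in> box (l $ i) (u $ i))"
  unfolding mem_box Basis_vec_def by (auto simp: inner_axis)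

lemma prod_Basis_vec:
  "(\<Prod>b\<in>(Basis :: ('a::euclidean_space^'n::finite) set). f b) = (\<Prod>i\<in>UNIV. \<Prod>u\<in>Basis. f (axis i u))"
proof -
  have "(\<Prod>i\<in>(UNIV::'n set). \<Prod>u\<in>(Basis::'a set). f (axis i u)) = (\<Prod>(i,u)\<in>UNIV\<times>Basis. f (axis i u))"
    by (simp add: prod.cartesian_product)
  also have "\<dots> = (\<Prod>b\<in>(Basis :: ('a^'n) set). f b)"
    by (rule prod.reindex_cong[symmetric, where l="\<lambda>(i,u). axis i u"])
       (auto simp: Basis_vec_def inj_on_def axis_eq_axis nonzero_Basis split: prod.splits)
  finally show ?thesis ..
qed

text \<open>
  The law of independent rows lives on a product of row spaces, while densities of a random matrix refer to
  \<open>lborel\<close> on the matrix space.  The two Lebesgue measures agree on boxes.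
\<close>

lemma lborel_vec_eq_PiM:
  "distr (PiM UNIV (\<lambda>_::'n::finite. lborel :: 'a::euclidean_space measure)) borel vec_lambda = lborel"
proof (rule lborel_eqI[symmetric])
  interpret product_sigma_finite "\<lambda>_::'n. lborel :: 'a measure"
    by standard
  have m: "vec_lambda \<in> borel_measurable (PiM UNIV (\<lambda>_::'n. lborel :: 'a measure))"
    using measurable_vec_lambda by (simp cong: sets_PiM_cong measurable_cong_sets)
  fix l u :: "'a^'n"
  assume le: "\<And>b. b \<in> Basis \<Longrightarrow> l \<bullet> b \<le> u \<bullet> b"
  then have le': "l $ i \<bullet> b \<le> u $ i \<bullet> b" if "b \<in> Basis" for i b
    using that by (metis axis_in_Basis_iff inner_axis)
  have "vec_lambda -` box l u \<inter> space (PiM UNIV (\<lambda>_::'n. lborel :: 'a measure))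
      = (\<Pi>\<^sub>E i\<in>UNIV. box (l $ i) (u $ i))"
    by (auto simp: mem_box_vec space_PiM PiE_iff)
  then show "emeasure (distr (PiM UNIV (\<lambda>_. lborel)) borel vec_lambda) (box l u)
      = ennreal (\<Prod>b\<in>Basis. (u - l) \<bullet> b)"
    using le' by (simp add: emeasure_distr[OF m] emeasure_PiM emeasure_lborel_box prod_Basis_vec
        inner_axis inner_diff_left prod_ennreal prod_nonneg)
qed simp

lemma nn_integral_lborel_translate:
  fixes f :: "'a::euclidean_space \<Rightarrow> ennreal"
  assumes [measurable]: "f \<in> borel_measurable borel"
  shows "(\<integral>\<^sup>+x. f (c + x) \<partial>lborel) = (\<integral>\<^sup>+x. f x \<partial>lborel)"
proof -
  have "(\<integral>\<^sup>+x. f x \<partial>lborel) = (\<integral>\<^sup>+x. f x \<partial>distr lborel borel ((+) c))"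
    by (simp add: lborel_distr_plus)
  also have "\<dots> = (\<integral>\<^sup>+x. f (c + x) \<partial>lborel)"
    by (rule nn_integral_distr) auto
  finally show ?thesis ..
qed

lemma nn_integral_lborel_scale:
  fixes f :: "'a::euclidean_space \<Rightarrow> ennreal" and c :: "'a \<Rightarrow> real"
  assumes [measurable]: "f \<in> borel_measurable borel" and c: "\<And>j. j \<in> Basis \<Longrightarrow> c j \<noteq> 0"
  shows "(\<integral>\<^sup>+x. f (\<Sum>j\<in>Basis. (c j * (x \<bullet> j)) *\<^sub>R j) \<partial>lborel)
    = ennreal (1 / (\<Prod>j\<in>Basis. \<bar>c j\<bar>)) * (\<integral>\<^sup>+x. f x \<partial>lborel)"
proof -
  let ?T = "\<lambda>x. \<Sum>j\<in>Basis. (c j * (x \<bullet> j)) *\<^sub>R j :: 'a"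
  let ?d = "\<Prod>j\<in>Basis. \<bar>c j\<bar>"
  have d: "?d > 0" using c by (intro prod_pos) auto
  have "lborel = density (distr lborel borel ?T) (\<lambda>_. ennreal ?d)"
    using lborel_affine_euclidean[of c 0] c by simp
  then have "(\<integral>\<^sup>+x. f x \<partial>lborel) = (\<integral>\<^sup>+x. f x \<partial>density (distr lborel borel ?T) (\<lambda>_. ennreal ?d))"
    by simp
  also have "\<dots> = ennreal ?d * (\<integral>\<^sup>+x. f (?T x) \<partial>lborel)"
    by (simp add: nn_integral_density nn_integral_distr nn_integral_cmult)
  finally show ?thesis using d c
    by (simp add: mult.assoc[symmetric] flip: ennreal_mult)
qed

lemma nn_integral_lborel_reflect:
  fixes f :: "'a::euclidean_space \<Rightarrow> ennreal"
  assumes [measurable]: "f \<in> borel_measurable borel"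
  shows "(\<integral>\<^sup>+x. f (c - x) \<partial>lborel) = (\<integral>\<^sup>+x. f x \<partial>lborel)"
proof -
  have "(\<integral>\<^sup>+x. f (c - x) \<partial>lborel) = (\<integral>\<^sup>+x. f (c + (\<Sum>j\<in>Basis. (- 1 * (x \<bullet> j)) *\<^sub>R j)) \<partial>lborel)"
    by (simp add: sum_negf euclidean_representation)
  also have "\<dots> = (\<integral>\<^sup>+x. f (c + x) \<partial>lborel)"
    by (subst nn_integral_lborel_scale[where f="\<lambda>x. f (c + x)"]) auto
  finally show ?thesis by (simp add: nn_integral_lborel_translate)
qed

text \<open>
  Uniqueness of Haar measure in a special case.  Integrating \<open>f (U x) g (U x + y)\<close> over \<open>x\<close> and \<open>y\<close> in
  both orders, with translations in between, gives
  \<open>(\<integral>g) (\<integral>f \<circ> U) = (\<integral>g \<circ> U) (\<integral>f)\<close>; for \<open>g\<close> the indicator of the unit ball, \<open>g \<circ> U = g\<close> and the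
  positive finite volume of the ball cancels.
\<close>

lemma nn_integral_lborel_orthogonal:
  fixes f :: "'a::euclidean_space \<Rightarrow> ennreal" and U :: "'a \<Rightarrow> 'a"
  assumes U: "orthogonal_transformation U" and f[measurable]: "f \<in> borel_measurable borel"
  shows "(\<integral>\<^sup>+x. f (U x) \<partial>lborel) = (\<integral>\<^sup>+x. f x \<partial>lborel)"
proof -
  \<comment> \<open>Any rotation-invariant test function of positive finite integral would do.\<close>
  define g :: "'a \<Rightarrow> ennreal" where "g = indicator (ball 0 1)"
  have [measurable]: "g \<in> borel_measurable borel" unfolding g_def by (intro borel_measurable_indicator) simp
  have linU: "linear U" using U by (rule orthogonal_transformation_linear)
  have [measurable]: "U \<in> borel_measurable borel"
    by (intro borel_measurable_continuous_onI linear_continuous_on linear_conv_bounded_linear[THEN iffD1] linU)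
  have gU: "g (U x) = g x" for x
    using U by (simp add: g_def indicator_def orthogonal_transformation_norm)
  let ?b = "\<integral>\<^sup>+y. g y \<partial>lborel"
  have b: "?b \<noteq> 0" "?b \<noteq> \<top>"
    using emeasure_lborel_ball_finite[of "0::'a" 1]
    by (auto simp: g_def emeasure_ball less_imp_neq[OF unit_ball_vol_pos, symmetric])
  have Uinv: "U (inv U y) = y" for y
    using U by (simp add: orthogonal_transformation_surj surj_f_inv_f)
  have "?b * (\<integral>\<^sup>+x. f (U x) \<partial>lborel) = (\<integral>\<^sup>+x. (\<integral>\<^sup>+y. f (U x) * g y \<partial>lborel) \<partial>lborel)"
    by (simp add: nn_integral_cmult nn_integral_multc mult.commute)
  also have "\<dots> = (\<integral>\<^sup>+x. (\<integral>\<^sup>+y. f (U x) * g (U x + y) \<partial>lborel) \<partial>lborel)"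
    by (intro nn_integral_cong nn_integral_lborel_translate[symmetric]) measurable
  also have "\<dots> = (\<integral>\<^sup>+y. (\<integral>\<^sup>+x. f (U x) * g (U x + y) \<partial>lborel) \<partial>lborel)"
    by (rule lborel_pair.Fubini') measurable
  also have "\<dots> = (\<integral>\<^sup>+y. (\<integral>\<^sup>+x. f (U x - y) * g (U x) \<partial>lborel) \<partial>lborel)"
  proof (rule nn_integral_cong)
    fix y :: 'a
    have "(\<integral>\<^sup>+x. f (U x) * g (U x + y) \<partial>lborel) = (\<integral>\<^sup>+x. f (U (- inv U y + x)) * g (U (- inv U y + x) + y) \<partial>lborel)"
      by (rule nn_integral_lborel_translate[symmetric]) measurable
    also have "\<dots> = (\<integral>\<^sup>+x. f (U x - y) * g (U x) \<partial>lborel)"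
      by (simp add: linear_add[OF linU] linear_diff[OF linU] Uinv)
    finally show "(\<integral>\<^sup>+x. f (U x) * g (U x + y) \<partial>lborel) = (\<integral>\<^sup>+x. f (U x - y) * g (U x) \<partial>lborel)" .
  qed
  also have "\<dots> = (\<integral>\<^sup>+x. (\<integral>\<^sup>+y. f (U x - y) * g (U x) \<partial>lborel) \<partial>lborel)"
    by (rule lborel_pair.Fubini') measurable
  also have "\<dots> = ?b * (\<integral>\<^sup>+y. f y \<partial>lborel)"
    by (simp add: nn_integral_multc nn_integral_lborel_reflect nn_integral_cmult gU mult.commute)
  finally show ?thesis using b by (simp add: ennreal_mult_cancel_left)
qed

text \<open>
  An orthogonal change of coordinates adapted to \<open>V\<close> and its orthogonal complement makes \<open>S\<close> diagonal, with
  eigenvalue 1 on \<open>V\<close> and \<open>c\<close> on the complement, so the Jacobian is read off without determinants.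
\<close>

lemma nn_integral_lborel_dilation:
  fixes f :: "'a::euclidean_space \<Rightarrow> ennreal" and S :: "'a \<Rightarrow> 'a"
  assumes V: "subspace V" and S: "linear S" and c: "c > 0"
    and SV: "\<And>x. x \<in> V \<Longrightarrow> S x = x"
    and SO: "\<And>x. (\<And>y. y \<in> V \<Longrightarrow> orthogonal y x) \<Longrightarrow> S x = c *\<^sub>R x"
    and [measurable]: "f \<in> borel_measurable borel"
  shows "(\<integral>\<^sup>+x. f (S x) \<partial>lborel) = ennreal (1 / c ^ (DIM('a) - dim V)) * (\<integral>\<^sup>+x. f x \<partial>lborel)"
proof -
  define W where "W = {x \<in> UNIV. \<forall>y\<in>V. orthogonal y x}"
  have W: "subspace W" unfolding W_def using subspace_orthogonal_to_vectors[of V] by simp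
  have dimW: "dim W = DIM('a) - dim V"
    using dim_subspace_orthogonal_to_vectors[OF V subspace_UNIV] by (simp add: W_def)
  obtain A where A: "A \<subseteq> V" "pairwise orthogonal A" "\<And>x. x \<in> A \<Longrightarrow> norm x = 1"
      "independent A" "card A = dim V" "span A = V"
    using orthonormal_basis_subspace[OF V] by metis
  obtain B where B: "B \<subseteq> W" "pairwise orthogonal B" "\<And>x. x \<in> B \<Longrightarrow> norm x = 1"
      "independent B" "card B = dim W" "span B = W"
    using orthonormal_basis_subspace[OF W] by metis
  have fin: "finite A" "finite B" using A B independent_imp_finite by auto
  have AB: "orthogonal x y" if "x \<in> A" "y \<in> B" for x y
    using that A B by (auto simp: W_def)
  have disj: "A \<inter> B = {}"
  proof (rule ccontr)
    assume "A \<inter> B \<noteq> {}"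
    then obtain x where "x \<in> A" "x \<in> B" by blast
    then show False using AB[of x x] A(3)[of x] by (simp add: orthogonal_self)
  qed
  have "card (A \<union> B) = DIM('a)"
    using fin disj A(5) B(5) dimW by (simp add: card_Un_disjoint dim_subset_UNIV)
  then obtain e where e: "bij_betw e (Basis :: 'a set) (A \<union> B)"
    using fin by (metis finite_Basis finite_Un finite_same_card_bij)
  have pw: "pairwise orthogonal (A \<union> B)"
    using AB AB[THEN orthogonal_commute[THEN iffD1]] A(2) B(2) by (auto simp: pairwise_def)
  have orth: "e i \<bullet> e j = (if i = j then 1 else 0)" if "i \<in> Basis" "j \<in> Basis" for i j
  proof -
    have "e i \<in> A \<union> B" "e j \<in> A \<union> B" using e that by (auto simp: bij_betw_def)
    moreover have "e i = e j \<longleftrightarrow> i = j" using e that by (auto simp: bij_betw_def inj_on_def)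
    ultimately show ?thesis
      using pw A(3) B(3) by (cases "i = j") (auto simp: pairwise_def orthogonal_def norm_eq_1)
  qed
  define U where "U x = (\<Sum>b\<in>Basis. (x \<bullet> b) *\<^sub>R e b)" for x
  have Ue: "U b = e b" if "b \<in> Basis" for b
  proof -
    have "U b = (\<Sum>b'\<in>Basis. if b' = b then e b' else 0)"
      unfolding U_def using that by (intro sum.cong) (auto simp: inner_Basis)
    then show ?thesis using that by simp
  qed
  have linU: "linear U"
    unfolding U_def by (intro linearI) (simp_all add: inner_add_left scaleR_add_left sum.distrib scaleR_sum_right)
  have UU: "orthogonal_transformation U"
    unfolding orthogonal_transformation_def
  proof (intro conjI allI)
    fix v w
    have "U v \<bullet> U w = (\<Sum>i\<in>Basis. \<Sum>j\<in>Basis. (v \<bullet> i) * ((w \<bullet> j) * (e i \<bullet> e j)))"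
      by (subst sum.swap) (simp add: U_def inner_sum_left inner_sum_right sum_distrib_left mult_ac)
    also have "\<dots> = (\<Sum>i\<in>Basis. \<Sum>j\<in>Basis. if i = j then (v \<bullet> i) * (w \<bullet> j) else 0)"
      by (intro sum.cong) (auto simp: orth)
    also have "\<dots> = (\<Sum>i\<in>Basis. (v \<bullet> i) * (w \<bullet> i))" by simp
    also have "\<dots> = v \<bullet> w" by (rule euclidean_inner[symmetric])
    finally show "U v \<bullet> U w = v \<bullet> w" .
  qed fact
  define k where "k b = (if e b \<in> A then 1 else c)" for b
  have SU: "S (U x) = U (\<Sum>b\<in>Basis. (k b * (x \<bullet> b)) *\<^sub>R b)" for x
  proof -
    have *: "S (e b) = k b *\<^sub>R e b" if "b \<in> Basis" for b
    proof (cases "e b \<in> A")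
      case False
      then have "e b \<in> W" using bij_betwE[OF e] that B(1) by blast
      then show ?thesis using SO False by (simp add: W_def k_def)
    qed (use A SV in \<open>auto simp: k_def\<close>)
    have "S (U x) = (\<Sum>b\<in>Basis. (x \<bullet> b) *\<^sub>R S (e b))"
      unfolding U_def by (simp add: linear_sum[OF S] linear_scale[OF S])
    also have "\<dots> = (\<Sum>b\<in>Basis. (k b * (x \<bullet> b)) *\<^sub>R U b)"
      by (intro sum.cong) (auto simp: * Ue)
    finally show ?thesis by (simp add: linear_sum[OF linU] linear_scale[OF linU])
  qed
  have "(\<Prod>b\<in>(Basis::'a set). \<bar>k b\<bar>) = (\<Prod>x\<in>A \<union> B. if x \<in> A then 1 else c)"
    unfolding prod.reindex_bij_betw[OF e, symmetric] using c by (intro prod.cong) (auto simp: k_def)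
  also have "\<dots> = (\<Prod>x\<in>A. 1) * (\<Prod>x\<in>B. c)"
  proof -
    have "(\<Prod>x\<in>B. if x \<in> A then 1 else c) = (\<Prod>x\<in>B. c)"
      using disj by (intro prod.cong) auto
    then show ?thesis using fin disj by (simp add: prod.union_disjoint)
  qed
  finally have pk: "(\<Prod>b\<in>(Basis::'a set). \<bar>k b\<bar>) = c ^ (DIM('a) - dim V)"
    using B(5) dimW by simp
  have [measurable]: "U \<in> borel_measurable borel" "S \<in> borel_measurable borel"
    by (intro borel_measurable_continuous_onI linear_continuous_on linear_conv_bounded_linear[THEN iffD1] linU S)+
  have "(\<integral>\<^sup>+x. f (S x) \<partial>lborel) = (\<integral>\<^sup>+x. f (U (\<Sum>b\<in>Basis. (k b * (x \<bullet> b)) *\<^sub>R b)) \<partial>lborel)"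
    by (subst nn_integral_lborel_orthogonal[OF UU, symmetric]) (auto simp: SU)
  also have "\<dots> = ennreal (1 / c ^ (DIM('a) - dim V)) * (\<integral>\<^sup>+x. f (U x) \<partial>lborel)"
    using nn_integral_lborel_scale[of "\<lambda>x. f (U x)" k] c by (simp add: pk) (simp add: k_def)
  finally show ?thesis by (simp add: nn_integral_lborel_orthogonal[OF UU])
qed

definition join_columns :: "real^'n \<Rightarrow> real^'q::finite^'n \<Rightarrow> real^('q option)^'n" where
  "join_columns x R = (\<chi> i j. case j of None \<Rightarrow> x $ i | Some k \<Rightarrow> R $ i $ k)"

lemma join_columns_nth [simp]: "join_columns x R $ i $ None = x $ i" "join_columns x R $ i $ Some k = R $ i $ k"
  by (simp_all add: join_columns_def)

lemma prod_UNIV_option: "(\<Prod>j\<in>(UNIV::'q::finite option set). f j) = f None * (\<Prod>k\<in>UNIV. f (Some k))"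
  by (simp add: UNIV_option_conv prod.reindex)

lemma measurable_join_columns [measurable]:
  "(\<lambda>(x, R). join_columns x R) \<in> borel_measurable (borel :: ((real^'n) \<times> (real^'q::finite^'n)) measure)"
proof (intro borel_measurable_continuous_onI)
  have "continuous_on UNIV (\<lambda>p::(real^'n) \<times> (real^'q^'n). case j of None \<Rightarrow> fst p $ i | Some k \<Rightarrow> snd p $ i $ k)" for i j
    by (cases j) (auto intro!: continuous_intros)
  then show "continuous_on UNIV (\<lambda>(x::real^'n, R::real^'q^'n). join_columns x R)"
    unfolding join_columns_def case_prod_unfold by (intro continuous_on_vec_lambda)
qed

lemma lborel_split_columns:
  "distr (lborel :: ((real^'n) \<times> (real^'q::finite^'n)) measure) borel (\<lambda>(x, R). join_columns x R) = lborel"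
proof (rule lborel_eqI[symmetric])
  fix l u :: "real^('q option)^'n"
  assume le: "\<And>b. b \<in> Basis \<Longrightarrow> l \<bullet> b \<le> u \<bullet> b"
  have le': "l $ i $ j \<le> u $ i $ j" for i j
    using le[of "axis i (axis j 1)"] by (simp add: axis_in_Basis_iff inner_axis)
  have eq: "(\<lambda>(x, R). join_columns x R) -` box l u = box (first_col l) (first_col u) \<times> box (rest_cols l) (rest_cols u)"
    by (auto simp: mem_box_vec first_col_def rest_cols_def column_def box_real)
       (metis option.exhaust join_columns_nth)+
  have "emeasure lborel ((\<lambda>(x, R). join_columns x R) -` box l u)
      = emeasure lborel (box (first_col l) (first_col u)) * emeasure lborel (box (rest_cols l) (rest_cols u))"
    unfolding eq lborel_prod[symmetric] by (subst lborel.emeasure_pair_measure_Times) auto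
  also have "\<dots> = ennreal (\<Prod>b\<in>Basis. (first_col u - first_col l) \<bullet> b)
      * ennreal (\<Prod>b\<in>Basis. (rest_cols u - rest_cols l) \<bullet> b)"
    using le' by (intro arg_cong2[where f="(*)"] emeasure_lborel_box)
      (auto simp: Basis_vec_def inner_axis first_col_def rest_cols_def column_def)
  also have "\<dots> = ennreal (\<Prod>b\<in>Basis. (u - l) \<bullet> b)"
    using le' by (simp add: prod_Basis_vec inner_axis first_col_def rest_cols_def column_def
        prod_UNIV_option prod.distrib prod_nonneg flip: ennreal_mult)
  finally show "emeasure (distr lborel borel (\<lambda>(x, R). join_columns x R)) (box l u) = ennreal (\<Prod>b\<in>Basis. (u - l) \<bullet> b)"
    by (simp add: emeasure_distr)
qed simp

section \<open>Matrices with independent rows\<close>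

text \<open>
  Both sides agree on measurable rectangles, where the integral of a product factorizes.
\<close>

lemma PiM_density:
  fixes f :: "'i \<Rightarrow> 'b \<Rightarrow> ennreal"
  assumes I: "finite I" and N: "\<And>i. sigma_finite_measure (N i)"
    and f: "\<And>i. f i \<in> borel_measurable (N i)"
    and D: "\<And>i. sigma_finite_measure (density (N i) (f i))"
  shows "PiM I (\<lambda>i. density (N i) (f i)) = density (PiM I N) (\<lambda>x. \<Prod>i\<in>I. f i (x i))"
proof -
  interpret N: product_sigma_finite N
    using N by (simp add: product_sigma_finite_def)
  interpret D: product_sigma_finite "\<lambda>i. density (N i) (f i)"
    using D by (simp add: product_sigma_finite_def)
  note f[measurable]
  show ?thesis
  proof (rule D.PiM_eqI[symmetric])
    show "sets (density (Pi\<^sub>M I N) (\<lambda>x. \<Prod>i\<in>I. f i (x i))) = sets (Pi\<^sub>M I (\<lambda>i. density (N i) (f i)))"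
      by (simp cong: sets_PiM_cong)
    fix A assume "\<And>i. i \<in> I \<Longrightarrow> A i \<in> sets (density (N i) (f i))"
    then have A: "A i \<in> sets (N i)" if "i \<in> I" for i using that by simp
    then have "emeasure (density (Pi\<^sub>M I N) (\<lambda>x. \<Prod>i\<in>I. f i (x i))) (Pi\<^sub>E I A)
        = (\<integral>\<^sup>+x. (\<Prod>i\<in>I. f i (x i)) * indicator (Pi\<^sub>E I A) x \<partial>PiM I N)"
      using I by (subst emeasure_density) (auto intro!: sets_PiM_I_finite)
    also have "\<dots> = (\<integral>\<^sup>+x. (\<Prod>i\<in>I. f i (x i) * indicator (A i) (x i)) \<partial>PiM I N)"
    proof (intro nn_integral_cong)
      fix x assume "x \<in> space (PiM I N)"
      then have "x \<in> Pi\<^sub>E I A \<longleftrightarrow> (\<forall>i\<in>I. x i \<in> A i)" by (auto simp: space_PiM PiE_iff)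
      then show "(\<Prod>i\<in>I. f i (x i)) * indicator (Pi\<^sub>E I A) x = (\<Prod>i\<in>I. f i (x i) * indicator (A i) (x i))"
        using I by (cases "x \<in> Pi\<^sub>E I A") (auto simp: prod_zero_iff indicator_def)
    qed
    also have "\<dots> = (\<Prod>i\<in>I. \<integral>\<^sup>+x. f i x * indicator (A i) x \<partial>N i)"
    proof (rule trans[OF N.product_nn_integral_prod[OF I, of "\<lambda>i x. f i x * indicator (A i) x"]])
      show "(\<lambda>x. f i x * indicator (A i) x) \<in> borel_measurable (N i)" if "i \<in> I" for i
        using A[OF that] by measurable
    qed simp
    also have "\<dots> = (\<Prod>i\<in>I. emeasure (density (N i) (f i)) (A i))"
      using A by (intro prod.cong) (auto simp: emeasure_density)
    finally show "emeasure (density (Pi\<^sub>M I N) (\<lambda>x. \<Prod>i\<in>I. f i (x i))) (Pi\<^sub>E I A)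
        = (\<Prod>i\<in>I. emeasure (density (N i) (f i)) (A i))" .
  qed fact
qed

lemma distr_eq_density_indep_rows:
  fixes X :: "'a \<Rightarrow> 'b::euclidean_space^'n"
  assumes "prob_space P"
    and indep: "prob_space.indep_vars P (\<lambda>_. borel) (\<lambda>i \<omega>. X \<omega> $ i) UNIV"
    and D: "\<And>i. distributed P lborel (\<lambda>\<omega>. X \<omega> $ i) (f i)"
  shows "distr P borel X = density lborel (\<lambda>x. \<Prod>i\<in>UNIV. f i (x $ i))"
proof -
  interpret prob_space P by fact
  have rv[measurable]: "(\<lambda>\<omega>. X \<omega> $ i) \<in> borel_measurable P" for i
    using D[of i] by (simp add: distributed_def)
  have f[measurable]: "f i \<in> borel_measurable borel" for i
    using D[of i] by (simp add: distributed_def)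
  have row: "distr P borel (\<lambda>\<omega>. X \<omega> $ i) = density lborel (f i)" for i
    using D[of i] by (simp add: distributed_def cong: distr_cong)
  have sf: "sigma_finite_measure (density lborel (f i))" for i
    unfolding row[symmetric] by (intro prob_space_imp_sigma_finite prob_space_distr rv)
  have m[measurable]: "vec_lambda \<in> borel_measurable (PiM UNIV (\<lambda>_::'n. borel :: 'b measure))"
    by (rule measurable_vec_lambda)
  have m'[measurable]: "vec_lambda \<in> borel_measurable (PiM UNIV (\<lambda>_::'n. lborel :: 'b measure))"
    using m by (simp cong: sets_PiM_cong measurable_cong_sets)
  have r[measurable]: "(\<lambda>\<omega>. \<lambda>i\<in>UNIV. X \<omega> $ i) \<in> measurable P (PiM UNIV (\<lambda>_. borel))"
    by (rule measurable_restrict) simp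
  have "distr P borel X = distr (distr P (PiM UNIV (\<lambda>_. borel)) (\<lambda>\<omega>. \<lambda>i\<in>UNIV. X \<omega> $ i)) borel vec_lambda"
    by (subst distr_distr[OF m r]) (simp add: comp_def vec_nth_inverse restrict_def)
  also have "distr P (PiM UNIV (\<lambda>_. borel)) (\<lambda>\<omega>. \<lambda>i\<in>UNIV. X \<omega> $ i) = PiM UNIV (\<lambda>i. density lborel (f i))"
    using indep_vars_iff_distr_eq_PiM[of UNIV "\<lambda>i \<omega>. X \<omega> $ i" "\<lambda>_. borel"] indep rv row by simp
  also have "\<dots> = density (PiM UNIV (\<lambda>_. lborel)) (\<lambda>x. \<Prod>i\<in>UNIV. f i (x i))"
    by (rule PiM_density) (auto simp: sf lborel.sigma_finite_measure_axioms)
  also have "distr \<dots> borel vec_lambda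
      = density (distr (PiM UNIV (\<lambda>_. lborel)) borel vec_lambda) (\<lambda>x. \<Prod>i\<in>UNIV. f i (x $ i))"
    by (subst density_distr) auto
  finally show "distr P borel X = density lborel (\<lambda>x. \<Prod>i\<in>UNIV. f i (x $ i))"
    by (simp add: lborel_vec_eq_PiM)
qed

section \<open>Matrix inverses and the block structure of a positive definite matrix\<close>

lemma matrix_inv_mult:
  fixes A :: "real^'q^'q"
  assumes "det A \<noteq> 0"
  shows "A ** matrix_inv A = mat 1" and "matrix_inv A ** A = mat 1"
proof -
  have "\<exists>B. A ** B = mat 1 \<and> B ** A = mat 1"
    using assms unfolding invertible_det_nz[symmetric] invertible_def by blast
  from someI_ex[OF this] show "A ** matrix_inv A = mat 1" "matrix_inv A ** A = mat 1"
    by (simp_all add: matrix_inv_def)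
qed

text \<open>
  For a singular matrix the choice operator in \<open>matrix_inv\<close> has an unsatisfiable predicate, hence its value is
  one and the same matrix for all singular arguments.  Measurability of the inverse rests on this.
\<close>

lemma matrix_inv_singular:
  fixes A :: "real^'q^'q"
  assumes "det A = 0"
  shows "matrix_inv A = (SOME _. False)"
proof -
  have "\<not> (\<exists>B. A ** B = mat 1 \<and> B ** A = mat 1)"
    using assms invertible_det_nz[of A] by (auto simp: invertible_def)
  then have "(\<lambda>B. A ** B = mat 1 \<and> B ** A = mat 1) = (\<lambda>_. False)" by blast
  then show ?thesis unfolding matrix_inv_def by (rule arg_cong)
qed

lemma det_nonzero_of_definite:
  fixes A :: "real^'q^'q"
  assumes "\<And>x. x \<noteq> 0 \<Longrightarrow> x \<bullet> (A *v x) \<noteq> 0"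
  shows "det A \<noteq> 0"
proof -
  have "\<exists>B. B ** A = mat 1"
    unfolding matrix_left_invertible_ker using assms by (metis inner_zero_right)
  then show ?thesis by (simp add: invertible_det_nz[symmetric] invertible_left_inverse)
qed

lemma sum_UNIV_option: "(\<Sum>j\<in>(UNIV::'q::finite option set). f j) = f None + (\<Sum>k\<in>UNIV. f (Some k))"
  by (simp add: UNIV_option_conv sum.reindex)

definition vcons :: "real \<Rightarrow> real^'q::finite \<Rightarrow> real^('q option)" where
  "vcons a v = (\<chi> j. case j of None \<Rightarrow> a | Some k \<Rightarrow> v $ k)"

lemma vcons_nth [simp]: "vcons a v $ None = a" "vcons a v $ Some k = v $ k"
  by (simp_all add: vcons_def)

lemma vcons_cases: obtains a v where "y = vcons a v"
proof
  show "y = vcons (y $ None) (\<chi> k. y $ Some k)"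
    by (simp add: vec_eq_iff split_option_all)
qed

lemma inner_vcons: "vcons a v \<bullet> vcons b w = a * b + v \<bullet> w"
  by (simp add: inner_vec_def sum_UNIV_option)

lemma vcons_eq_iff: "vcons a v = vcons b w \<longleftrightarrow> a = b \<and> v = w"
  by (simp add: vec_eq_iff split_option_all)

lemma matrix_vector_mult_vcons:
  assumes "transpose A = A"
  shows "A *v vcons a v = vcons (A $ None $ None * a + block21 A \<bullet> v) (a *\<^sub>R block21 A + block22 A *v v)"
proof -
  have "A $ None $ Some k = A $ Some k $ None" for k
  proof -
    have "transpose A $ None $ Some k = A $ Some k $ None" by (simp add: transpose_def)
    then show ?thesis by (simp add: assms)
  qed
  then have "(A *v vcons a v) $ j = vcons (A $ None $ None * a + block21 A \<bullet> v) (a *\<^sub>R block21 A + block22 A *v v) $ j" for j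
    by (cases j) (simp_all add: matrix_vector_mult_def sum_UNIV_option block21_def block22_def inner_vec_def)
  then show ?thesis by (simp add: vec_eq_iff)
qed

lemma transpose_block22: "transpose A = A \<Longrightarrow> transpose (block22 A) = block22 A"
  by (simp add: vec_eq_iff transpose_def block22_def)

lemma symmetric_inner:
  fixes A :: "real^'q^'q"
  assumes "transpose A = A"
  shows "x \<bullet> (A *v y) = (A *v x) \<bullet> y"
  using assms by (metis dot_lmul_matrix transpose_matrix_vector)

text \<open>
  Coefficients of the linear regression of the first coordinate on the others.
\<close>

definition regression_coeffs :: "real^('q::finite option)^('q option) \<Rightarrow> real^'q" where
  "regression_coeffs \<Sigma> = matrix_inv (block22 \<Sigma>) *v block21 \<Sigma>"

context
  fixes \<Sigma> :: "real^('q::finite option)^('q option)"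
  assumes pd: "positive_definite \<Sigma>"
begin

lemma posdef_symmetric: "transpose \<Sigma> = \<Sigma>" and posdef_quadratic_pos: "x \<noteq> 0 \<Longrightarrow> x \<bullet> (\<Sigma> *v x) > 0"
  using pd by (auto simp: positive_definite_def)

lemma det_posdef: "det \<Sigma> \<noteq> 0"
  by (rule det_nonzero_of_definite) (metis posdef_quadratic_pos less_irrefl)

lemma det_block22_posdef: "det (block22 \<Sigma>) \<noteq> 0"
proof (rule det_nonzero_of_definite)
  fix v :: "real^'q" assume "v \<noteq> 0"
  then have "vcons 0 v \<noteq> 0" by (simp add: vec_eq_iff split_option_all)
  from posdef_quadratic_pos[OF this] show "v \<bullet> (block22 \<Sigma> *v v) \<noteq> 0"
    by (simp add: matrix_vector_mult_vcons[OF posdef_symmetric] inner_vcons)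
qed

lemma block22_regression_coeffs: "block22 \<Sigma> *v regression_coeffs \<Sigma> = block21 \<Sigma>"
  by (simp add: regression_coeffs_def matrix_vector_mul_assoc matrix_inv_mult[OF det_block22_posdef])

text \<open>
  The Schur complement is the value of the quadratic form of \<open>\<Sigma>\<close> at the vector with first entry 1 and
  remaining entries \<open>- regression_coeffs \<Sigma>\<close>.
\<close>

lemma schur_compl_posdef: "schur_compl \<Sigma> > 0"
proof -
  have "vcons 1 (- regression_coeffs \<Sigma>) \<noteq> 0" by (simp add: vec_eq_iff split_option_all)
  from posdef_quadratic_pos[OF this] show ?thesis
    by (simp add: matrix_vector_mult_vcons[OF posdef_symmetric] inner_vcons block22_regression_coeffs schur_compl_def
        linear_neg[OF matrix_vector_mul_linear] flip: regression_coeffs_def)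
qed

text \<open>
  If \<open>\<Sigma>\<close> maps \<open>(b, w)\<close> to \<open>(a, v)\<close>, eliminating \<open>w\<close> gives
  \<open>a - v \<bullet> regression_coeffs \<Sigma> = schur_compl \<Sigma> * b\<close>.  In density terms: the normal density of a row is the
  conditional density of its first entry times a function of the other entries.
\<close>

lemma inverse_quadratic_form:
  "vcons a v \<bullet> (matrix_inv \<Sigma> *v vcons a v)
    = (a - v \<bullet> regression_coeffs \<Sigma>)\<^sup>2 / schur_compl \<Sigma> + v \<bullet> (matrix_inv (block22 \<Sigma>) *v v)"
proof -
  obtain b w where bw: "matrix_inv \<Sigma> *v vcons a v = vcons b w" by (rule vcons_cases)
  have "\<Sigma> *v vcons b w = vcons a v"
    by (simp add: bw[symmetric] matrix_vector_mul_assoc matrix_inv_mult[OF det_posdef])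
  then have a: "a = \<Sigma> $ None $ None * b + block21 \<Sigma> \<bullet> w" and v: "v = b *\<^sub>R block21 \<Sigma> + block22 \<Sigma> *v w"
    by (auto simp: matrix_vector_mult_vcons[OF posdef_symmetric] vcons_eq_iff)
  have iv: "matrix_inv (block22 \<Sigma>) *v v = b *\<^sub>R regression_coeffs \<Sigma> + w"
    by (simp add: v matrix_vector_right_distrib matrix_vector_mult_scaleR regression_coeffs_def
        matrix_vector_mul_assoc matrix_inv_mult[OF det_block22_posdef])
  have wr: "(block22 \<Sigma> *v w) \<bullet> regression_coeffs \<Sigma> = block21 \<Sigma> \<bullet> w"
    using symmetric_inner[OF transpose_block22[OF posdef_symmetric], of w "regression_coeffs \<Sigma>"]
    by (simp add: block22_regression_coeffs inner_commute)
  have d: "a - v \<bullet> regression_coeffs \<Sigma> = schur_compl \<Sigma> * b"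
    by (simp add: a v inner_add_left wr schur_compl_def algebra_simps flip: regression_coeffs_def)
  have "vcons a v \<bullet> (matrix_inv \<Sigma> *v vcons a v) = (a - v \<bullet> regression_coeffs \<Sigma>) * b + v \<bullet> (b *\<^sub>R regression_coeffs \<Sigma> + w)"
    by (simp add: bw inner_vcons inner_add_right algebra_simps)
  also have "(a - v \<bullet> regression_coeffs \<Sigma>) * b = (a - v \<bullet> regression_coeffs \<Sigma>)\<^sup>2 / schur_compl \<Sigma>"
    using schur_compl_posdef by (simp add: d power2_eq_square)
  finally show ?thesis by (simp add: iv)
qed
end

section \<open>Rank deficiency and measurability of the inverse\<close>

text \<open>
  By translation invariance the measure of \<open>Z\<close> is the average over \<open>t \<in> [0,1]\<close> of the measures of
  \<open>Z - t d\<close>.  By Tonelli this is an integral of the lengths of the slices of \<open>Z\<close> along \<open>d\<close>, all of which vanish.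
\<close>

lemma null_set_finite_on_lines:
  fixes Z :: "'a::euclidean_space set"
  assumes Z: "Z \<in> sets borel" and fin: "\<And>x. finite {t. t *\<^sub>R d + x \<in> Z}"
  shows "Z \<in> null_sets lborel"
proof -
  let ?I = "indicator {0..1} :: real \<Rightarrow> ennreal"
  have Z'[measurable]: "Measurable.pred borel (\<lambda>x. x \<in> Z)" using Z by (simp add: pred_def)
  have [measurable]: "indicator Z \<in> borel_measurable (borel :: 'a measure)"
    using Z by (rule borel_measurable_indicator)
  have "emeasure lborel Z = (\<integral>\<^sup>+t. ?I t * (\<integral>\<^sup>+x. indicator Z (t *\<^sub>R d + x) \<partial>lborel) \<partial>lborel)"
    using Z by (simp add: nn_integral_lborel_translate nn_integral_multc)
  also have "\<dots> = (\<integral>\<^sup>+t. (\<integral>\<^sup>+x. ?I t * indicator Z (t *\<^sub>R d + x) \<partial>lborel) \<partial>lborel)"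
    by (intro nn_integral_cong nn_integral_cmult[symmetric]) measurable
  also have "\<dots> = (\<integral>\<^sup>+x. (\<integral>\<^sup>+t. ?I t * indicator Z (t *\<^sub>R d + x) \<partial>lborel) \<partial>lborel)"
    by (rule lborel_pair.Fubini') measurable
  also have "\<dots> = (\<integral>\<^sup>+x. 0 \<partial>(lborel :: 'a measure))"
  proof (rule nn_integral_cong)
    fix x
    have "AE t in lborel. t \<notin> {t. t *\<^sub>R d + x \<in> Z}"
      by (intro AE_not_in finite_imp_null_set_lborel fin)
    then have "(\<integral>\<^sup>+t. ?I t * indicator Z (t *\<^sub>R d + x) \<partial>lborel) = (\<integral>\<^sup>+t. 0 \<partial>(lborel::real measure))"
      by (intro nn_integral_cong_AE) (auto elim!: eventually_mono)
    then show "(\<integral>\<^sup>+t. ?I t * indicator Z (t *\<^sub>R d + x) \<partial>lborel) = 0" by simp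
  qed
  finally show ?thesis using Z by (auto simp: null_sets_def)
qed

lemma measurable_det:
  fixes A :: "'a \<Rightarrow> real^'q^'q"
  assumes [measurable]: "\<And>i j. (\<lambda>x. A x $ i $ j) \<in> borel_measurable M"
  shows "(\<lambda>x. det (A x)) \<in> borel_measurable M"
  unfolding det_def by measurable

lemma poly_det: "poly (det A) s = det (\<chi> i j. poly (A $ i $ j) s)"
  for A :: "real poly^'q^'q"
  by (simp add: det_def poly_sum poly_prod)

text \<open>
  Move along a fixed matrix \<open>D\<close> with orthonormal columns.  The determinant of
  \<open>(D + s R)\<^sup>T (D + s R)\<close> is a polynomial in \<open>s\<close> with value 1 at \<open>s = 0\<close>, so it has finitely many roots; and
  for \<open>t \<noteq> 0\<close> the matrix \<open>t D + R\<close> is rank deficient only if \<open>1 / t\<close> is such a root.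
\<close>

lemma null_set_rank_deficient:
  assumes "CARD('q::finite) \<le> CARD('n::finite)"
  shows "{R :: real^'q^'n. det (transpose R ** R) = 0} \<in> null_sets lborel"
proof -
  obtain e :: "'q \<Rightarrow> 'n" where e: "inj e"
    using assms card_le_inj[of "UNIV::'q set" "UNIV::'n set"] by auto
  define D :: "real^'q^'n" where "D = (\<chi> i j. if i = e j then 1 else 0)"
  have DD: "transpose D ** D = mat 1"
  proof -
    have "(\<Sum>k\<in>UNIV. (if k = e i then 1 else 0) * (if k = e j then 1 else 0)) = (if i = j then 1 else (0::real))" for i j
    proof -
      have "(if k = e i then 1 else 0) * (if k = e j then 1 else 0) = (if k = e i then (if i = j then 1 else 0) else (0::real))" for k
        using e by (simp add: inj_eq)
      then show ?thesis by simp
    qed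
    then show ?thesis by (simp add: vec_eq_iff matrix_matrix_mult_def transpose_def D_def mat_def)
  qed
  show ?thesis
  proof (rule null_set_finite_on_lines[where d=D])
    have "(\<lambda>R::real^'q^'n. det (transpose R ** R)) \<in> borel_measurable borel"
      by (rule measurable_det) (simp add: matrix_matrix_mult_def transpose_def)
    then have "(\<lambda>R::real^'q^'n. det (transpose R ** R)) -` {0} \<inter> space borel \<in> sets borel"
      by (rule measurable_sets) simp
    then show "{R :: real^'q^'n. det (transpose R ** R) = 0} \<in> sets borel"
      by (simp add: vimage_def)
    fix R :: "real^'q^'n"
    define G where "G s = transpose (D + s *\<^sub>R R) ** (D + s *\<^sub>R R)" for s
    \<comment> \<open>The same determinant, computed over the polynomial ring.\<close>
    define p where "p = det (\<chi> i j. \<Sum>k\<in>UNIV. [:D $ k $ i, R $ k $ i:] * [:D $ k $ j, R $ k $ j:])"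
    have p: "poly p s = det (G s)" for s
      unfolding p_def poly_det G_def
      by (simp add: poly_sum matrix_matrix_mult_def transpose_def algebra_simps)
    have "poly p 0 = 1" by (simp add: p G_def DD)
    then have "finite {s. poly p s = 0}" by (intro poly_roots_finite) auto
    moreover have "{t. t *\<^sub>R D + R \<in> {R. det (transpose R ** R) = 0}} \<subseteq> insert 0 (inverse ` {s. poly p s = 0})"
    proof (intro subsetI)
      fix t assume t: "t \<in> {t. t *\<^sub>R D + R \<in> {R. det (transpose R ** R) = 0}}"
      show "t \<in> insert 0 (inverse ` {s. poly p s = 0})"
      proof (cases "t = 0")
        case False
        have "t *\<^sub>R D + R = t *\<^sub>R (D + inverse t *\<^sub>R R)" using False by (simp add: algebra_simps)
        then have "transpose (t *\<^sub>R D + R) ** (t *\<^sub>R D + R) = t\<^sup>2 *\<^sub>R G (inverse t)"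
          by (simp add: G_def vec_eq_iff matrix_matrix_mult_def transpose_def sum_distrib_left power2_eq_square mult_ac)
        then have "det (t\<^sup>2 *\<^sub>R G (inverse t)) = 0" using t by simp
        moreover have "det (t\<^sup>2 *\<^sub>R G (inverse t)) = (t\<^sup>2) ^ CARD('q) * det (G (inverse t))"
          using det_rows_mul[of "\<lambda>_. t\<^sup>2" "\<lambda>i. G (inverse t) $ i"]
          by (simp add: scalar_mult_eq_scaleR[symmetric] vec_lambda_eta scaleR_vec_def vec_eq_iff)
        ultimately have "poly p (inverse t) = 0" using False p by simp
        then show ?thesis by (metis (mono_tags) imageI insertI2 inverse_inverse_eq mem_Collect_eq)
      qed simp
    qed
    ultimately show "finite {t. t *\<^sub>R D + R \<in> {R. det (transpose R ** R) = 0}}"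
      by (meson finite_imageI finite_insert finite_subset)
  qed
qed

text \<open>
  Off the singular matrices Cramer's rule gives each entry as a quotient of determinants; on them
  \<open>matrix_inv\<close> is constant.
\<close>

lemma measurable_matrix_inv:
  fixes A :: "'a \<Rightarrow> real^'q^'q"
  assumes [measurable]: "\<And>i j. (\<lambda>x. A x $ i $ j) \<in> borel_measurable M"
  shows "(\<lambda>x. matrix_inv (A x) $ i $ j) \<in> borel_measurable M"
proof -
  define B where "B x = (\<chi> i' j'. if j' = i then axis j 1 $ i' else A x $ i' $ j')" for x
  have "matrix_inv (A x) $ i $ j = det (B x) / det (A x)" if "det (A x) \<noteq> 0" for x
  proof -
    have "A x *v (matrix_inv (A x) *v axis j 1) = axis j 1"
      by (simp add: matrix_vector_mul_assoc matrix_inv_mult[OF that])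
    then have "(matrix_inv (A x) *v axis j 1) $ i = det (B x) / det (A x)"
      unfolding cramer[OF that] by (simp add: B_def)
    then show ?thesis by (simp add: matrix_vector_mult_basis column_def)
  qed
  then have eq: "(\<lambda>x. matrix_inv (A x) $ i $ j)
      = (\<lambda>x. if det (A x) = 0 then (SOME _. False) $ i $ j else det (B x) / det (A x))"
    by (auto simp: fun_eq_iff matrix_inv_singular)
  have [measurable]: "(\<lambda>x. det (A x)) \<in> borel_measurable M" "(\<lambda>x. det (B x)) \<in> borel_measurable M"
    by (intro measurable_det; simp add: B_def)+
  show ?thesis unfolding eq by measurable
qed

section \<open>A Gaussian integral tilted along a projection\<close>

text \<open>
  Moment-generating function of the squared length of the projection \<open>Q y\<close> for \<open>y\<close> normal with mean \<open>m\<close> and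
  covariance \<open>s I\<close>.  The density is left unnormalized, so that the same integral appears on both sides and
  only the Jacobian of the square-completing map has to be computed.
\<close>

lemma nn_integral_gaussian_tilt:
  fixes Q :: "'a::euclidean_space \<Rightarrow> 'a" and m :: 'a
  assumes Q: "linear Q" and idem: "\<And>x. Q (Q x) = Q x" and sym: "\<And>x y. Q x \<bullet> y = x \<bullet> Q y"
    and \<theta>: "\<theta> < 1/2" and s: "s > 0"
  shows "(\<integral>\<^sup>+y. ennreal (exp (\<theta> * (y \<bullet> Q y) / s - (norm (y - m))\<^sup>2 / (2 * s))) \<partial>lborel)
    = ennreal ((1 - 2 * \<theta>) powr (- real (DIM('a) - dim {x. Q x = 0}) / 2)
        * exp (\<theta> / (1 - 2 * \<theta>) * ((m \<bullet> Q m) / s)))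
      * (\<integral>\<^sup>+y. ennreal (exp (- (norm (y - m))\<^sup>2 / (2 * s))) \<partial>lborel)"
proof -
  define c where "c = sqrt (1 - 2 * \<theta>)"
  have c: "c > 0" and c2: "c\<^sup>2 = 1 - 2 * \<theta>" using \<theta> by (auto simp: c_def)
  define k where "k = DIM('a) - dim {x. Q x = 0}"
  define S where "S y = y + (c - 1) *\<^sub>R Q y" for y
  \<comment> \<open>\<open>m'\<close> is the image of \<open>m\<close> under the inverse of \<open>S\<close>, as completing the square requires.\<close>
  define m' where "m' = m + (1 / c - 1) *\<^sub>R Q m"
  have exponent: "\<theta> * (y \<bullet> Q y) / s - (norm (y - m))\<^sup>2 / (2 * s)
      = \<theta> / (1 - 2 * \<theta>) * ((m \<bullet> Q m) / s) + - (norm (S y - m'))\<^sup>2 / (2 * s)" for y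
  proof -
    \<comment> \<open>All mixed inner products reduce to six quantities, and the coefficient of \<open>y \<bullet> Q m\<close> then cancels.\<close>
    have QQ: "Q v \<bullet> Q w = v \<bullet> Q w" for v w by (metis idem sym)
    have sw: "Q m \<bullet> y = y \<bullet> Q m" "m \<bullet> Q y = y \<bullet> Q m" "Q y \<bullet> m = y \<bullet> Q m" "m \<bullet> y = y \<bullet> m"
        "Q m \<bullet> m = m \<bullet> Q m" "Q y \<bullet> y = y \<bullet> Q y"
      by (simp_all add: inner_commute sym) (metis inner_commute sym)+
    have "(norm (S y - m'))\<^sup>2 = y \<bullet> y + (c\<^sup>2 - 1) * (y \<bullet> Q y) + m \<bullet> m + (1 / c\<^sup>2 - 1) * (m \<bullet> Q m) - 2 * (y \<bullet> m)"
      using c by (simp add: power2_norm_eq_inner S_def m'_def inner_add_left inner_add_right inner_diff_left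
          inner_diff_right QQ sw) (simp add: field_simps power2_eq_square)
    moreover have "(norm (y - m))\<^sup>2 = y \<bullet> y + m \<bullet> m - 2 * (y \<bullet> m)"
      by (simp add: power2_norm_eq_inner inner_diff_left inner_diff_right sw)
    moreover define \<kappa> where "\<kappa> = \<theta> / (1 - 2 * \<theta>)"
    moreover have "1 / c\<^sup>2 - 1 = 2 * \<kappa>" using \<theta> by (simp add: \<kappa>_def c2 field_simps)
    ultimately have N: "(norm (S y - m'))\<^sup>2 = (norm (y - m))\<^sup>2 - 2 * \<theta> * (y \<bullet> Q y) + 2 * \<kappa> * (m \<bullet> Q m)"
      by (simp add: c2)
    show ?thesis unfolding N \<kappa>_def[symmetric] using s by (simp add: field_simps)
  qed
  have linS: "linear S"
    unfolding S_def by (intro linear_compose_add linear_compose_scale_right linear_id[unfolded id_def] Q)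
  have "(\<integral>\<^sup>+y. ennreal (exp (- (norm (S y - m'))\<^sup>2 / (2 * s))) \<partial>lborel)
      = ennreal (1 / c ^ k) * (\<integral>\<^sup>+y. ennreal (exp (- (norm (y - m'))\<^sup>2 / (2 * s))) \<partial>lborel)"
    unfolding k_def
  proof (rule nn_integral_lborel_dilation[OF _ linS c])
    show "subspace {x. Q x = 0}" using Q by (rule linear_subspace_kernel)
    fix x assume x: "\<And>y. y \<in> {x. Q x = 0} \<Longrightarrow> orthogonal y x"
    \<comment> \<open>\<open>x - Q x\<close> lies in the kernel of \<open>Q\<close>, to which \<open>x\<close> is orthogonal, so it vanishes.\<close>
    have "orthogonal (x - Q x) x" by (rule x) (simp add: linear_diff[OF Q] idem)
    then have "(x - Q x) \<bullet> (x - Q x) = 0"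
      by (simp add: orthogonal_def inner_diff_left inner_diff_right sym idem)
    then have "Q x = x" by simp
    then show "S x = c *\<^sub>R x" by (simp add: S_def algebra_simps)
  qed (auto simp: S_def)
  also have "(\<integral>\<^sup>+y. ennreal (exp (- (norm (y - m'))\<^sup>2 / (2 * s))) \<partial>lborel)
      = (\<integral>\<^sup>+y. ennreal (exp (- (norm (y - m))\<^sup>2 / (2 * s))) \<partial>lborel)"
  proof -
    have "m' - m + y - m' = y - m" for y by simp
    then show ?thesis
      using nn_integral_lborel_translate[of "\<lambda>y. ennreal (exp (- (norm (y - m'))\<^sup>2 / (2 * s)))" "m' - m"]
      by simp
  qed
  also have "1 / c ^ k = (1 - 2 * \<theta>) powr (- real k / 2)"
  proof -
    have "c = (1 - 2 * \<theta>) powr (1 / 2)" using \<theta> by (simp add: c_def powr_half_sqrt)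
    then have "c ^ k = (1 - 2 * \<theta>) powr (real k / 2)"
      using c by (simp add: powr_realpow[symmetric] powr_powr)
    then show ?thesis by (simp add: powr_minus_divide)
  qed
  finally have I: "(\<integral>\<^sup>+y. ennreal (exp (- (norm (S y - m'))\<^sup>2 / (2 * s))) \<partial>lborel)
      = ennreal ((1 - 2 * \<theta>) powr (- real k / 2))
        * (\<integral>\<^sup>+y. ennreal (exp (- (norm (y - m))\<^sup>2 / (2 * s))) \<partial>lborel)" .
  have [measurable]: "S \<in> borel_measurable borel"
    by (intro borel_measurable_continuous_onI linear_continuous_on linear_conv_bounded_linear[THEN iffD1] linS)
  define K where "K = exp (\<theta> / (1 - 2 * \<theta>) * ((m \<bullet> Q m) / s))"
  have "(\<integral>\<^sup>+y. ennreal (exp (\<theta> * (y \<bullet> Q y) / s - (norm (y - m))\<^sup>2 / (2 * s))) \<partial>lborel)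
      = (\<integral>\<^sup>+y. ennreal K * ennreal (exp (- (norm (S y - m'))\<^sup>2 / (2 * s))) \<partial>lborel)"
    unfolding exponent exp_add K_def by (simp only: ennreal_mult exp_ge_zero)
  also have "\<dots> = ennreal K * (\<integral>\<^sup>+y. ennreal (exp (- (norm (S y - m'))\<^sup>2 / (2 * s))) \<partial>lborel)"
    by (rule nn_integral_cmult) measurable
  finally show ?thesis
    unfolding I k_def[symmetric] K_def[symmetric]
    by (simp add: ennreal_mult K_def mult_ac)
qed

text \<open>
  For \<open>R\<close> of full column rank, the least-squares residual of \<open>x\<close> regressed on the columns of \<open>R\<close>; as a
  matrix this is \<open>Q2\<close>.
\<close>

definition residual :: "real^'q^'n \<Rightarrow> real^'n \<Rightarrow> real^'n" where
  "residual R x = x - R *v (matrix_inv (transpose R ** R) *v (transpose R *v x))"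

lemma residual_eq: "residual R = (*v) (mat 1 - R ** matrix_inv (transpose R ** R) ** transpose R)"
  by (simp add: fun_eq_iff residual_def matrix_vector_mult_diff_rdistrib matrix_vector_mul_assoc matrix_mul_assoc
      del: transpose_matrix_vector)

lemma linear_residual: "linear (residual R)"
  by (simp add: residual_eq)

context
  fixes R :: "real^'q^'n"
  assumes R: "det (transpose R ** R) \<noteq> 0"
begin

lemma residual_range: "residual R (R *v b) = 0"
  by (simp add: residual_def matrix_vector_mul_assoc matrix_mul_assoc[symmetric] matrix_inv_mult[OF R])

lemma transpose_residual: "transpose R *v residual R x = 0"
  by (simp add: residual_def matrix_vector_mult_diff_distrib matrix_vector_mul_assoc matrix_mul_assoc matrix_inv_mult[OF R]
      del: transpose_matrix_vector)

lemma residual_idem: "residual R (residual R x) = residual R x"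
  by (subst residual_def) (simp add: transpose_residual del: transpose_matrix_vector)

lemma residual_self_adjoint: "residual R x \<bullet> y = x \<bullet> residual R y"
proof -
  have *: "residual R x \<bullet> (R *v b) = 0" for x b
    using transpose_residual[of x] by (metis dot_lmul_matrix inner_zero_left transpose_matrix_vector)
  have "residual R x \<bullet> y = residual R x \<bullet> residual R y"
    by (subst (2) residual_def) (simp add: inner_diff_right *)
  also have "\<dots> = x \<bullet> residual R y"
    by (subst residual_def) (simp add: inner_diff_left, metis * inner_commute)
  finally show ?thesis .
qed

lemma dim_kernel_residual: "dim {x. residual R x = 0} = CARD('q)"
proof -
  have "{x. residual R x = 0} = range ((*v) R)"
    by (auto simp: residual_range) (auto simp: residual_def)
  moreover have "inj ((*v) R)"
    unfolding matrix_left_invertible_injective[symmetric]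
    using matrix_inv_mult(2)[OF R] by (metis matrix_mul_assoc)
  ultimately show ?thesis by (metis full_rank_injective rank_dim_range)
qed
end

section \<open>Disintegration of the Gaussian matrix law\<close>

text \<open>
  The function \<open>g i\<close> collects the normalizing constant and the quadratic form in the entries other than the
  first.  It is left unspecified: the integrals over the first column are compared with each other, and
  common factors depending on \<open>R\<close> carry over from one to the other.
\<close>

lemma mv_normal_density_row:
  fixes \<Sigma> :: "real^('q::finite option)^('q option)" and M :: "real^('q option)^'n"
  assumes pd: "positive_definite \<Sigma>"
  obtains g :: "'n \<Rightarrow> real^'q \<Rightarrow> real" where "\<And>i. g i \<in> borel_measurable borel"
    and "\<And>i x R. mv_normal_density (M $ i) \<Sigma> (join_columns x R $ i)
      = exp (- ((x - R *v regression_coeffs \<Sigma> - m_tilde M \<Sigma>) $ i)\<^sup>2 / (2 * schur_compl \<Sigma>)) * g i (R $ i)"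
proof
  define g where "g i r = exp (- ((r - rest_cols M $ i) \<bullet> (matrix_inv (block22 \<Sigma>) *v (r - rest_cols M $ i))) / 2)
      / sqrt ((2 * pi) ^ CARD('q option) * det \<Sigma>)" for i and r :: "real^'q"
  show "g i \<in> borel_measurable borel" for i
  proof -
    have "(\<lambda>r. (r - rest_cols M $ i) \<bullet> (matrix_inv (block22 \<Sigma>) *v (r - rest_cols M $ i))) \<in> borel_measurable borel"
      unfolding matrix_vector_mult_def by (intro borel_measurable_continuous_onI continuous_intros)
    then show ?thesis unfolding g_def by measurable
  qed
  fix i and x :: "real^'n" and R :: "real^'q^'n"
  have row: "join_columns x R $ i - M $ i = vcons (x $ i - first_col M $ i) (R $ i - rest_cols M $ i)"
    by (simp add: vec_eq_iff split_option_all first_col_def rest_cols_def column_def)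
  have "x $ i - first_col M $ i - (R $ i - rest_cols M $ i) \<bullet> regression_coeffs \<Sigma> = (x - R *v regression_coeffs \<Sigma> - m_tilde M \<Sigma>) $ i"
    by (simp add: m_tilde_def regression_coeffs_def[symmetric] inner_diff_left matrix_vector_mul_component)
  moreover have "- (a / s + q) / 2 = - a / (2 * s) + - q / 2" for a s q :: real
    by (simp add: add_divide_distrib)
  ultimately show "mv_normal_density (M $ i) \<Sigma> (join_columns x R $ i)
      = exp (- ((x - R *v regression_coeffs \<Sigma> - m_tilde M \<Sigma>) $ i)\<^sup>2 / (2 * schur_compl \<Sigma>)) * g i (R $ i)"
    unfolding mv_normal_density_def row inverse_quadratic_form[OF pd] g_def
    by (simp only: exp_add times_divide_eq_right)
qed

lemma gaussian_matrix_measurable: "gaussian_matrix P X M \<Sigma> \<Longrightarrow> X \<in> borel_measurable P"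
  by (rule measurable_vecI) (auto simp: gaussian_matrix_def distributed_def)

text \<open>
  Integration of the first column given the others: up to a weight \<open>G\<close> depending only on \<open>R\<close>, the first column
  has a spherical Gaussian density centred at \<open>R b + m\<close>, where \<open>b\<close> are the regression coefficients
  and \<open>m\<close> is \<open>m_tilde M \<Sigma>\<close>.
\<close>

lemma gaussian_matrix_nn_integral:
  fixes \<Sigma> :: "real^('q::finite option)^('q option)" and M :: "real^('q option)^'n"
  assumes P: "prob_space P" and pd: "positive_definite \<Sigma>" and X: "gaussian_matrix P X M \<Sigma>"
  obtains G :: "real^'q^'n \<Rightarrow> ennreal" where "G \<in> borel_measurable borel"
    and "\<And>F. F \<in> borel_measurable borel \<Longrightarrow> (\<integral>\<^sup>+\<omega>. F (X \<omega>) \<partial>P)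
      = (\<integral>\<^sup>+R. G R * (\<integral>\<^sup>+x. ennreal (exp (- (norm (x - R *v regression_coeffs \<Sigma> - m_tilde M \<Sigma>))\<^sup>2 / (2 * schur_compl \<Sigma>)))
          * F (join_columns x R) \<partial>lborel) \<partial>lborel)"
proof -
  obtain g where g[measurable]: "\<And>i. g i \<in> borel_measurable borel"
    and dens: "\<And>i x R. mv_normal_density (M $ i) \<Sigma> (join_columns x R $ i)
      = exp (- ((x - R *v regression_coeffs \<Sigma> - m_tilde M \<Sigma>) $ i)\<^sup>2 / (2 * schur_compl \<Sigma>)) * g i (R $ i)"
    using mv_normal_density_row[OF pd, of M] by metis
  define f where "f i y = ennreal (mv_normal_density (M $ i) \<Sigma> y)" for i y
  define K where "K x R = ennreal (exp (- (norm (x - R *v regression_coeffs \<Sigma> - m_tilde M \<Sigma>))\<^sup>2 / (2 * schur_compl \<Sigma>)))"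
    for x and R :: "real^'q^'n"
  define G where "G R = (\<Prod>i\<in>UNIV. ennreal (g i (R $ i)))" for R
  have fm[measurable]: "f i \<in> borel_measurable borel" for i
    using X by (auto simp: gaussian_matrix_def distributed_def f_def[abs_def])
  note Xm = gaussian_matrix_measurable[OF X]
  have law: "distr P borel X = density lborel (\<lambda>x. \<Prod>i\<in>UNIV. f i (x $ i))"
    using distr_eq_density_indep_rows[OF P, of X f] X by (auto simp: gaussian_matrix_def f_def[abs_def])
  have Gm[measurable]: "G \<in> borel_measurable borel" unfolding G_def by measurable
  have "continuous_on UNIV (\<lambda>p :: (real^'n) \<times> (real^'q^'n). fst p - snd p *v regression_coeffs \<Sigma> - m_tilde M \<Sigma>)"
    unfolding matrix_vector_mult_def by (intro continuous_intros)
  from borel_measurable_continuous_onI[OF this]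
  have Km[measurable]: "(\<lambda>p. K (fst p) (snd p)) \<in> borel_measurable borel"
    unfolding K_def by measurable
  have sec[measurable]: "(\<lambda>x. (x, R)) \<in> measurable borel (borel :: ((real^'n) \<times> (real^'q^'n)) measure)" for R
    by (intro borel_measurable_continuous_onI continuous_intros)
  have Kx[measurable]: "(\<lambda>x. K x R) \<in> borel_measurable borel" for R
    using measurable_compose[OF sec Km] by simp
  have snd_m: "snd \<in> measurable (borel :: ((real^'n) \<times> (real^'q^'n)) measure) borel"
    by (intro borel_measurable_continuous_onI continuous_intros)
  have prod_f: "(\<Prod>i\<in>UNIV. f i (join_columns x R $ i)) = G R * K x R" for x R
  proof -
    let ?z = "x - R *v regression_coeffs \<Sigma> - m_tilde M \<Sigma>"
    have "(\<Prod>i\<in>UNIV. f i (join_columns x R $ i))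
        = (\<Prod>i\<in>UNIV. ennreal (exp (- (?z $ i)\<^sup>2 / (2 * schur_compl \<Sigma>)))) * G R"
      unfolding f_def dens by (subst ennreal_mult') (simp_all add: prod.distrib G_def)
    also have "(\<Prod>i\<in>UNIV. ennreal (exp (- (?z $ i)\<^sup>2 / (2 * schur_compl \<Sigma>)))) = K x R"
    proof -
      have "(norm ?z)\<^sup>2 = (\<Sum>i\<in>UNIV. (?z $ i)\<^sup>2)"
        unfolding power2_norm_eq_inner inner_vec_def by (simp only: inner_real_def power2_eq_square)
      then have "- (norm ?z)\<^sup>2 / (2 * schur_compl \<Sigma>) = (\<Sum>i\<in>UNIV. - (?z $ i)\<^sup>2 / (2 * schur_compl \<Sigma>))"
        by (simp only: sum_divide_distrib[symmetric] sum_negf)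
      then show ?thesis unfolding K_def by (simp only: exp_sum finite prod_ennreal exp_ge_zero)
    qed
    finally show ?thesis by (simp add: mult.commute)
  qed
  show thesis
  proof (rule that[OF Gm])
    fix F :: "real^('q option)^'n \<Rightarrow> ennreal" assume F[measurable]: "F \<in> borel_measurable borel"
    have pm: "(\<lambda>p::(real^'n) \<times> (real^'q^'n). F (join_columns (fst p) (snd p))) \<in> borel_measurable borel"
      using measurable_compose[OF measurable_join_columns F] by (simp add: case_prod_unfold)
    have "(\<integral>\<^sup>+\<omega>. F (X \<omega>) \<partial>P) = (\<integral>\<^sup>+A. F A \<partial>distr P borel X)"
      using Xm by (simp add: nn_integral_distr)
    also have "\<dots> = (\<integral>\<^sup>+A. (\<Prod>i\<in>UNIV. f i (A $ i)) * F A \<partial>lborel)"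
      by (simp add: law nn_integral_density)
    also have "\<dots> = (\<integral>\<^sup>+A. (\<Prod>i\<in>UNIV. f i (A $ i)) * F A
        \<partial>distr (lborel :: ((real^'n) \<times> (real^'q^'n)) measure) borel (\<lambda>(x, R). join_columns x R))"
      by (simp add: lborel_split_columns)
    also have "\<dots> = (\<integral>\<^sup>+p. G (snd p) * K (fst p) (snd p) * F (join_columns (fst p) (snd p))
        \<partial>(lborel :: ((real^'n) \<times> (real^'q^'n)) measure))"
      using measurable_join_columns by (subst nn_integral_distr) (auto simp: case_prod_unfold prod_f)
    also have "\<dots> = (\<integral>\<^sup>+p. G (snd p) * K (fst p) (snd p) * F (join_columns (fst p) (snd p))
        \<partial>((lborel :: (real^'n) measure) \<Otimes>\<^sub>M (lborel :: (real^'q^'n) measure)))"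
      by (simp add: lborel_prod)
    also have "\<dots> = (\<integral>\<^sup>+R. (\<integral>\<^sup>+x. G R * K x R * F (join_columns x R) \<partial>lborel) \<partial>lborel)"
    proof (subst lborel_pair.nn_integral_snd[symmetric])
      show "(\<lambda>p. G (snd p) * K (fst p) (snd p) * F (join_columns (fst p) (snd p)))
          \<in> borel_measurable ((lborel :: (real^'n) measure) \<Otimes>\<^sub>M (lborel :: (real^'q^'n) measure))"
        unfolding lborel_prod using measurable_compose[OF snd_m Gm] Km pm by simp
    qed simp
    also have "\<dots> = (\<integral>\<^sup>+R. G R * (\<integral>\<^sup>+x. K x R * F (join_columns x R) \<partial>lborel) \<partial>lborel)"
    proof (rule nn_integral_cong)
      fix R :: "real^'q^'n"
      have "(\<lambda>x. F (join_columns x R)) \<in> borel_measurable borel"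
        using measurable_compose[OF sec pm] by simp
      then show "(\<integral>\<^sup>+x. G R * K x R * F (join_columns x R) \<partial>lborel) = G R * (\<integral>\<^sup>+x. K x R * F (join_columns x R) \<partial>lborel)"
        by (subst nn_integral_cmult[symmetric]) (auto simp: mult.assoc)
    qed
    finally show "(\<integral>\<^sup>+\<omega>. F (X \<omega>) \<partial>P)
      = (\<integral>\<^sup>+R. G R * (\<integral>\<^sup>+x. ennreal (exp (- (norm (x - R *v regression_coeffs \<Sigma> - m_tilde M \<Sigma>))\<^sup>2 / (2 * schur_compl \<Sigma>)))
          * F (join_columns x R) \<partial>lborel) \<partial>lborel)"
      by (simp add: K_def)
  qed
qed

section \<open>Moment-generating function given the remaining columns\<close>

lemma rest_cols_join_columns [simp]: "rest_cols (join_columns x R) = R"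
  by (simp add: vec_eq_iff rest_cols_def)

lemma Q2_mult: "Q2 X *v x = residual (rest_cols X) x"
  by (simp add: Q2_def residual_eq)

text \<open>
  If the other columns are linearly independent, both sides are the squared distance of the first column from
  their span.
\<close>

lemma schur_compl_gram: "schur_compl (transpose X ** X) = first_col X \<bullet> residual (rest_cols X) (first_col X)"
proof -
  have a: "(transpose X ** X) $ None $ None = first_col X \<bullet> first_col X"
    by (simp add: matrix_matrix_mult_def transpose_def first_col_def column_def inner_vec_def)
  have b: "block21 (transpose X ** X) = transpose (rest_cols X) *v first_col X"
    by (simp add: vec_eq_iff block21_def matrix_matrix_mult_def matrix_vector_mult_def transpose_def
        rest_cols_def first_col_def column_def del: transpose_matrix_vector)
  have c: "block22 (transpose X ** X) = transpose (rest_cols X) ** rest_cols X"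
    by (simp add: vec_eq_iff block22_def matrix_matrix_mult_def transpose_def rest_cols_def)
  have "(transpose R *v x) \<bullet> v = x \<bullet> (R *v v)" for R :: "real^'a^'b" and x v
    by (simp add: dot_lmul_matrix)
  then show ?thesis
    by (simp add: schur_compl_def a b c residual_def inner_diff_right del: transpose_matrix_vector)
qed

lemma measurable_residual_form:
  fixes f g :: "'a \<Rightarrow> real^'n" and R :: "'a \<Rightarrow> real^'q^'n"
  assumes f: "\<And>i. (\<lambda>x. f x $ i) \<in> borel_measurable M" and g: "\<And>i. (\<lambda>x. g x $ i) \<in> borel_measurable M"
    and R: "\<And>i j. (\<lambda>x. R x $ i $ j) \<in> borel_measurable M"
  shows "(\<lambda>x. f x \<bullet> residual (R x) (g x)) \<in> borel_measurable M"
proof -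
  have "(\<lambda>x. (transpose (R x) ** R x) $ i $ j) \<in> borel_measurable M" for i j
    unfolding matrix_matrix_mult_def transpose_def using R by simp
  then have [measurable]: "(\<lambda>x. matrix_inv (transpose (R x) ** R x) $ i $ j) \<in> borel_measurable M" for i j
    by (rule measurable_matrix_inv)
  note f[measurable] g[measurable] R[measurable]
  have "(\<lambda>x. transpose (R x) $ i $ j) \<in> borel_measurable M" for i j
    by (simp add: transpose_def)
  note this[measurable]
  show ?thesis
    unfolding inner_vec_def residual_def matrix_vector_mult_def
    by (simp del: transpose_matrix_vector)
qed

lemma measurable_rho: "rho \<Sigma> \<in> borel_measurable (borel :: (real^('q::finite option)^'n) measure)"
  unfolding rho_def schur_compl_gram
  by (intro borel_measurable_divide measurable_residual_form)
     (simp_all add: first_col_def rest_cols_def column_def)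

lemma measurable_u_ratio: "u_ratio M \<Sigma> \<in> borel_measurable (borel :: (real^('q::finite option)^'n) measure)"
  unfolding u_ratio_def Q2_mult
  by (intro borel_measurable_divide measurable_residual_form)
     (simp_all add: rest_cols_def)

text \<open>
  After the shift \<open>x = R b + y\<close>, which \<open>residual R\<close> does not see, this is the tilted Gaussian integral for the
  projection \<open>Q = residual R\<close>; the constant \<open>(m \<bullet> Q m) / \<sigma>\<close> that it produces, with \<open>m = m_tilde M \<Sigma>\<close> and
  \<open>\<sigma> = schur_compl \<Sigma>\<close>, is \<open>\<lambda> u\<close>.
\<close>

lemma mgf_rho_given_rest_cols:
  fixes \<Sigma> :: "real^('q::finite option)^('q option)" and M :: "real^('q option)^'n" and R :: "real^'q^'n"
  assumes pd: "positive_definite \<Sigma>" and m: "m_tilde M \<Sigma> \<noteq> 0"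
    and R: "det (transpose R ** R) \<noteq> 0" and \<theta>: "\<theta> < 1/2"
  defines "K x \<equiv> ennreal (exp (- (norm (x - R *v regression_coeffs \<Sigma> - m_tilde M \<Sigma>))\<^sup>2 / (2 * schur_compl \<Sigma>)))"
  shows "(\<integral>\<^sup>+x. K x * ennreal (exp (\<theta> * rho \<Sigma> (join_columns x R))) \<partial>lborel)
    = ennreal ((1 - 2 * \<theta>) powr (- real (CARD('n) - CARD('q)) / 2))
      * (\<integral>\<^sup>+x. K x * ennreal (exp (\<theta> / (1 - 2 * \<theta>) * (noncentrality M \<Sigma> * u_ratio M \<Sigma> (join_columns x R)))) \<partial>lborel)"
proof -
  let ?m = "m_tilde M \<Sigma>" and ?s = "schur_compl \<Sigma>" and ?b = "R *v regression_coeffs \<Sigma>"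
  let ?e = "exp (\<theta> / (1 - 2 * \<theta>) * ((?m \<bullet> residual R ?m) / ?s))"
  have s: "?s > 0" by (rule schur_compl_posdef[OF pd])
  have fc: "first_col (join_columns x R) = x" for x
    by (simp add: vec_eq_iff first_col_def column_def)
  have rho: "rho \<Sigma> (join_columns (?b + y) R) = (y \<bullet> residual R y) / ?s" for y
    by (simp add: rho_def schur_compl_gram fc linear_add[OF linear_residual] residual_range[OF R]
        inner_add_left residual_self_adjoint[OF R, symmetric])
  have u: "noncentrality M \<Sigma> * u_ratio M \<Sigma> (join_columns x R) = (?m \<bullet> residual R ?m) / ?s" for x
    using m by (simp add: noncentrality_def u_ratio_def Q2_mult)
  have Km: "K \<in> borel_measurable borel" unfolding K_def by measurable
  have Kb: "K (?b + y) = ennreal (exp (- (norm (y - ?m))\<^sup>2 / (2 * ?s)))" for y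
    by (simp add: K_def)
  have rm: "(\<lambda>x. rho \<Sigma> (join_columns x R)) \<in> borel_measurable borel"
    unfolding rho_def schur_compl_gram fc rest_cols_join_columns
    by (intro borel_measurable_divide measurable_residual_form) simp_all
  have "(\<integral>\<^sup>+x. K x * ennreal (exp (\<theta> * rho \<Sigma> (join_columns x R))) \<partial>lborel)
      = (\<integral>\<^sup>+y. K (?b + y) * ennreal (exp (\<theta> * rho \<Sigma> (join_columns (?b + y) R))) \<partial>lborel)"
    using Km rm by (intro nn_integral_lborel_translate[symmetric]) simp
  also have "\<dots> = (\<integral>\<^sup>+y. ennreal (exp (\<theta> * (y \<bullet> residual R y) / ?s - (norm (y - ?m))\<^sup>2 / (2 * ?s))) \<partial>lborel)"
    unfolding Kb rho by (intro nn_integral_cong) (simp add: ennreal_mult[symmetric] exp_add[symmetric])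
  also have "\<dots> = ennreal ((1 - 2 * \<theta>) powr (- real (CARD('n) - CARD('q)) / 2) * ?e)
      * (\<integral>\<^sup>+y. ennreal (exp (- (norm (y - ?m))\<^sup>2 / (2 * ?s))) \<partial>lborel)"
    using nn_integral_gaussian_tilt[OF linear_residual residual_idem[OF R] residual_self_adjoint[OF R] \<theta> s, of ?m]
    by (simp add: dim_kernel_residual[OF R])
  also have "(\<integral>\<^sup>+y. ennreal (exp (- (norm (y - ?m))\<^sup>2 / (2 * ?s))) \<partial>lborel) = (\<integral>\<^sup>+x. K x \<partial>lborel)"
    unfolding Kb[symmetric] using Km by (rule nn_integral_lborel_translate)
  moreover have "(\<integral>\<^sup>+x. K x * ennreal ?e \<partial>lborel) = (\<integral>\<^sup>+x. K x \<partial>lborel) * ennreal ?e"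
    using Km by (intro nn_integral_multc) simp
  ultimately show ?thesis
    unfolding u by (simp only: ennreal_mult[OF powr_ge_zero exp_ge_zero] mult_ac)
qed

text \<open>
  The identity for fixed \<open>R\<close>, averaged over \<open>R\<close>.  It holds for the \<open>R\<close> of full column rank, hence almost
  everywhere.
\<close>

lemma mgf_rho_eq_exp_moment_u_ratio:
  fixes \<Sigma> :: "real^('q::finite option)^('q option)" and M :: "real^('q option)^'n"
  assumes P: "prob_space P" and n: "CARD('q) \<le> CARD('n)" and pd: "positive_definite \<Sigma>"
    and X: "gaussian_matrix P X M \<Sigma>" and m: "m_tilde M \<Sigma> \<noteq> 0" and \<theta>: "\<theta> < 1/2"
  shows "(\<integral>\<^sup>+\<omega>. ennreal (exp (\<theta> * rho \<Sigma> (X \<omega>))) \<partial>P)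
    = ennreal ((1 - 2 * \<theta>) powr (- real (CARD('n) - CARD('q)) / 2))
      * (\<integral>\<^sup>+\<omega>. ennreal (exp (\<theta> / (1 - 2 * \<theta>) * (noncentrality M \<Sigma> * u_ratio M \<Sigma> (X \<omega>)))) \<partial>P)"
proof -
  let ?c = "ennreal ((1 - 2 * \<theta>) powr (- real (CARD('n) - CARD('q)) / 2))"
  let ?F = "\<lambda>A. ennreal (exp (\<theta> * rho \<Sigma> A))"
  let ?g = "\<lambda>A. ennreal (exp (\<theta> / (1 - 2 * \<theta>) * (noncentrality M \<Sigma> * u_ratio M \<Sigma> A)))"
  let ?F' = "\<lambda>A. ?c * ?g A"
  let ?K = "\<lambda>x R. ennreal (exp (- (norm (x - R *v regression_coeffs \<Sigma> - m_tilde M \<Sigma>))\<^sup>2 / (2 * schur_compl \<Sigma>)))"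
  note [measurable] = measurable_rho measurable_u_ratio
  obtain G :: "real^'q^'n \<Rightarrow> ennreal" where
    G: "\<And>F. F \<in> borel_measurable borel \<Longrightarrow> (\<integral>\<^sup>+\<omega>. F (X \<omega>) \<partial>P)
      = (\<integral>\<^sup>+R. G R * (\<integral>\<^sup>+x. ?K x R * F (join_columns x R) \<partial>lborel) \<partial>lborel)"
    by (rule gaussian_matrix_nn_integral[OF P pd X]) blast
  have Xm: "X \<in> borel_measurable P"
    using X by (rule gaussian_matrix_measurable)
  have "AE R in lborel. R \<notin> {R :: real^'q^'n. det (transpose R ** R) = 0}"
    by (rule AE_not_in[OF null_set_rank_deficient[OF n]])
  then have ae: "AE R in (lborel :: (real^'q^'n) measure). (\<integral>\<^sup>+x. ?K x R * ?F (join_columns x R) \<partial>lborel)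
      = (\<integral>\<^sup>+x. ?K x R * ?F' (join_columns x R) \<partial>lborel)"
  proof (rule eventually_mono)
    fix R :: "real^'q^'n" assume "R \<notin> {R :: real^'q^'n. det (transpose R ** R) = 0}"
    then have R: "det (transpose R ** R) \<noteq> 0" by simp
    \<comment> \<open>The ratio \<open>u\<close> depends on the remaining columns only, so the first one may be set to 0.\<close>
    define w where "w = ennreal (exp (\<theta> / (1 - 2 * \<theta>) * (noncentrality M \<Sigma> * u_ratio M \<Sigma> (join_columns 0 R))))"
    have u: "?g (join_columns x R) = w" for x
      by (simp add: u_ratio_def Q2_mult w_def)
    have "(\<lambda>x. ?K x R) \<in> borel_measurable borel" by measurable
    then have "(\<integral>\<^sup>+x. ?c * (?K x R * w) \<partial>lborel) = ?c * (\<integral>\<^sup>+x. ?K x R * w \<partial>lborel)"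
      by (intro nn_integral_cmult) simp
    then show "(\<integral>\<^sup>+x. ?K x R * ?F (join_columns x R) \<partial>lborel) = (\<integral>\<^sup>+x. ?K x R * ?F' (join_columns x R) \<partial>lborel)"
      unfolding mgf_rho_given_rest_cols[OF pd m R \<theta>] u by (simp only: mult.left_commute)
  qed
  have "(\<integral>\<^sup>+\<omega>. ?F (X \<omega>) \<partial>P) = (\<integral>\<^sup>+R. G R * (\<integral>\<^sup>+x. ?K x R * ?F (join_columns x R) \<partial>lborel) \<partial>lborel)"
    by (rule G) measurable
  also have "\<dots> = (\<integral>\<^sup>+R. G R * (\<integral>\<^sup>+x. ?K x R * ?F' (join_columns x R) \<partial>lborel) \<partial>lborel)"
    using ae by (intro nn_integral_cong_AE) (auto elim!: eventually_mono)
  also have "\<dots> = (\<integral>\<^sup>+\<omega>. ?F' (X \<omega>) \<partial>P)"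
    by (rule G[symmetric]) measurable
  also have "\<dots> = ?c * (\<integral>\<^sup>+\<omega>. ennreal (exp (\<theta> / (1 - 2 * \<theta>) * (noncentrality M \<Sigma> * u_ratio M \<Sigma> (X \<omega>)))) \<partial>P)"
    using Xm by (intro nn_integral_cmult) measurable
  finally show ?thesis .
qed

section \<open>Summing over the mixture weights\<close>

text \<open>
  Exchange of the exponential series with the integral.  On the support \<open>[0,1]\<close> of \<open>h\<close> the factor
  \<open>u\<^sup>k e\<^bsup>-au\<^esup>\<close> is at most 1, so the integrals are dominated by the terms of the series of \<open>exp (s a)\<close> times
  the total mass of \<open>h\<close>.
\<close>

lemma exponential_moment_sums:
  fixes h :: "real \<Rightarrow> real"
  assumes h: "integrable lborel h" and h0: "\<And>x. 0 \<le> h x" and supp: "\<And>x. x \<notin> {0..1} \<Longrightarrow> h x = 0"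
    and a: "0 \<le> a" and s: "0 \<le> s"
  shows "integrable lborel (\<lambda>u. h u * exp ((s - 1) * a * u))"
    and "(\<lambda>k. s ^ k * (a ^ k / fact k * (\<integral>u. h u * (u ^ k * exp (- a * u)) \<partial>lborel)))
      sums (\<integral>u. h u * exp ((s - 1) * a * u) \<partial>lborel)"
proof -
  note [measurable] = borel_measurable_integrable[OF h]
  have bound: "integrable lborel (\<lambda>u. h u * w u)"
    if [measurable]: "w \<in> borel_measurable borel" and w: "\<And>u. u \<in> {0..1} \<Longrightarrow> \<bar>w u\<bar> \<le> B" for w B
  proof (rule Bochner_Integration.integrable_bound)
    show "integrable lborel (\<lambda>u. B * h u)" using h by simp
    show "AE u in lborel. norm (h u * w u) \<le> norm (B * h u)"
    proof (intro AE_I2)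
      fix u show "norm (h u * w u) \<le> norm (B * h u)"
      proof (cases "u \<in> {0..1}")
        case True
        then have "\<bar>w u\<bar> \<le> \<bar>B\<bar>" using w[of u] by linarith
        then have "\<bar>h u\<bar> * \<bar>w u\<bar> \<le> \<bar>h u\<bar> * \<bar>B\<bar>" by (rule mult_left_mono) simp
        then show ?thesis by (simp add: abs_mult mult.commute)
      qed (simp add: supp)
    qed
  qed measurable
  show int: "integrable lborel (\<lambda>u. h u * exp ((s - 1) * a * u))"
  proof (rule bound[where B="exp (\<bar>(s - 1) * a\<bar>)"])
    fix u :: real assume "u \<in> {0..1}"
    then have "\<bar>(s - 1) * a\<bar> * \<bar>u\<bar> \<le> \<bar>(s - 1) * a\<bar> * 1"
      by (intro mult_left_mono) auto
    then have "(s - 1) * a * u \<le> \<bar>(s - 1) * a\<bar>"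
      unfolding abs_mult[symmetric] by linarith
    then show "\<bar>exp ((s - 1) * a * u)\<bar> \<le> exp (\<bar>(s - 1) * a\<bar>)" by simp
  qed measurable
  define f where "f k u = (s * a) ^ k / fact k * (h u * (u ^ k * exp (- a * u)))" for k u
  have unit: "\<bar>u ^ k * exp (- a * u)\<bar> \<le> 1" if "u \<in> {0..1}" for u :: real and k
    using that a by (auto simp: abs_mult power_le_one intro!: mult_le_one)
  have fi: "integrable lborel (\<lambda>u. h u * (u ^ k * exp (- a * u)))" for k
    by (rule bound[where B=1]) (use unit in auto)
  have f_nonneg: "0 \<le> f k u" for k u
    using supp[of u] h0[of u] a s by (cases "u \<in> {0..1}") (auto simp: f_def)
  have f_sums: "(\<lambda>k. f k u) sums (h u * exp ((s - 1) * a * u))" for u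
  proof -
    have "(\<lambda>k. (h u * exp (- a * u)) * ((s * a * u) ^ k /\<^sub>R fact k)) sums ((h u * exp (- a * u)) * exp (s * a * u))"
      by (intro sums_mult exp_converges)
    moreover have "(h u * exp (- a * u)) * exp (s * a * u) = h u * exp ((s - 1) * a * u)"
      by (simp add: mult.assoc exp_add[symmetric] algebra_simps)
    moreover have "(h u * exp (- a * u)) * ((s * a * u) ^ k /\<^sub>R fact k) = f k u" for k
      by (simp add: f_def power_mult_distrib divide_inverse mult_ac)
    ultimately show ?thesis by (simp only:)
  qed
  have "(\<lambda>k. integral\<^sup>L lborel (f k)) sums (\<integral>u. (\<Sum>k. f k u) \<partial>lborel)"
  proof (rule sums_integral)
    show "integrable lborel (f k)" for k unfolding f_def using fi by simp
    show "AE u in lborel. summable (\<lambda>k. norm (f k u))"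
      using f_nonneg f_sums by (auto simp: sums_iff)
    show "summable (\<lambda>k. \<integral>u. norm (f k u) \<partial>lborel)"
    proof (rule summable_comparison_test')
      show "summable (\<lambda>k. (s * a) ^ k / fact k * integral\<^sup>L lborel h)"
        using summable_exp_generic[of "s * a"] by (intro summable_mult2) (simp add: divide_inverse mult.commute)
      fix k :: nat
      have "(\<integral>u. h u * (u ^ k * exp (- a * u)) \<partial>lborel) \<le> integral\<^sup>L lborel h"
      proof (rule integral_mono[OF fi h])
        fix u show "h u * (u ^ k * exp (- a * u)) \<le> h u"
          using unit[of u k] supp[of u] h0[of u] by (cases "u \<in> {0..1}") (auto intro!: mult_left_le)
      qed
      then have "integral\<^sup>L lborel (f k) \<le> (s * a) ^ k / fact k * integral\<^sup>L lborel h"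
        unfolding f_def using a s by (simp add: divide_right_mono mult_left_mono)
      then show "norm (\<integral>u. norm (f k u) \<partial>lborel) \<le> (s * a) ^ k / fact k * integral\<^sup>L lborel h"
        using f_nonneg by (simp add: integral_nonneg)
    qed
  qed
  moreover have "integral\<^sup>L lborel (f k) = s ^ k * (a ^ k / fact k * (\<integral>u. h u * (u ^ k * exp (- a * u)) \<partial>lborel))" for k
    by (simp add: f_def[abs_def] power_mult_distrib)
  moreover have "(\<Sum>k. f k u) = h u * exp ((s - 1) * a * u)" for u
    using f_sums sums_unique by metis
  ultimately show "(\<lambda>k. s ^ k * (a ^ k / fact k * (\<integral>u. h u * (u ^ k * exp (- a * u)) \<partial>lborel)))
      sums (\<integral>u. h u * exp ((s - 1) * a * u) \<partial>lborel)" by simp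
qed

theorem proposition1:
  fixes P :: "'a measure"
    and X :: "'a \<Rightarrow> real^('q::finite option)^'n"
    and M :: "real^('q option)^'n"
    and \<Sigma> :: "real^('q option)^('q option)"
    and h :: "real \<Rightarrow> real"
    and \<nu> :: real
  assumes "prob_space P"
    and "CARD('q option) \<le> CARD('n)"
    and "positive_definite \<Sigma>"
    and "gaussian_matrix P X M \<Sigma>"
    and "m_tilde M \<Sigma> \<noteq> 0"
    and "pdf_on_unit P (\<lambda>\<omega>. u_ratio M \<Sigma> (X \<omega>)) h"
    and "\<nu> = real CARD('n) - real CARD('q option) + 1"
  shows "\<forall>\<theta><1/2.
           integrable P (\<lambda>\<omega>. exp (\<theta> * rho \<Sigma> (X \<omega>))) \<and>
           summable (\<lambda>k. (1 / (1 - 2 * \<theta>)) ^ k * mix_weight (noncentrality M \<Sigma>) h k) \<and>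
           mgf P (\<lambda>\<omega>. rho \<Sigma> (X \<omega>)) \<theta> =
             (1 - 2 * \<theta>) powr (- \<nu> / 2) *
             pgf (mix_weight (noncentrality M \<Sigma>) h) (1 / (1 - 2 * \<theta>))"
proof (intro allI impI)
  fix \<theta> :: real assume \<theta>: "\<theta> < 1/2"
  interpret prob_space P by fact
  define l where "l = noncentrality M \<Sigma>"
  define s where "s = 1 / (1 - 2 * \<theta>)"
  define H where "H u = indicator {0..1} u * h u" for u
  define U where "U \<omega> = u_ratio M \<Sigma> (X \<omega>)" for \<omega>
  have l: "0 \<le> l"
    using schur_compl_posdef[OF assms(3)] by (simp add: l_def noncentrality_def)
  have s: "0 \<le> s" using \<theta> by (simp add: s_def)
  have q: "CARD('q) \<le> CARD('n)" and \<nu>: "\<nu> = real (CARD('n) - CARD('q))"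
    using assms(2,7) by (simp_all add: card_UNIV_option of_nat_diff)
  have D: "distributed P lborel U (\<lambda>u. ennreal (H u))" and hpos: "\<And>u. u \<in> {0..1} \<Longrightarrow> 0 \<le> h u"
    using assms(6) by (auto simp: pdf_on_unit_def H_def[abs_def] U_def[abs_def])
  have H0: "0 \<le> H u" for u using hpos by (simp add: H_def indicator_def)
  have Hi: "integrable lborel H"
    using distributed_integrable[OF D, of "\<lambda>_. 1"] H0 by simp
  have supp: "H u = 0" if "u \<notin> {0..1}" for u using that by (simp add: H_def)
  have exponent: "(s - 1) * (l / 2) * u = \<theta> / (1 - 2 * \<theta>) * (l * u)" for u
    using \<theta> by (simp add: s_def field_simps)
  have weight: "mix_weight l h k = (l / 2) ^ k / fact k * (\<integral>u. H u * (u ^ k * exp (- (l / 2) * u)) \<partial>lborel)" for k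
    by (simp add: mix_weight_def set_lebesgue_integral_def H_def mult_ac)
  define W where "W u = exp (\<theta> / (1 - 2 * \<theta>) * (l * u))" for u
  have Wm: "W \<in> borel_measurable lborel" unfolding W_def by measurable
  define I where "I = (\<integral>u. H u * W u \<partial>lborel)"
  have moments: "integrable lborel (\<lambda>u. H u * W u)" "(\<lambda>k. s ^ k * mix_weight l h k) sums I"
    using exponential_moment_sums[OF Hi H0 supp _ s, of "l / 2"] l
    unfolding weight I_def W_def exponent by simp_all
  have EU: "integrable P (\<lambda>\<omega>. W (U \<omega>))" "(\<integral>\<omega>. W (U \<omega>) \<partial>P) = I"
    using distributed_integrable[OF D Wm H0] distributed_integral[OF D Wm H0] moments(1) by (simp_all add: I_def)
  have I0: "0 \<le> I" unfolding EU(2)[symmetric] by (intro Bochner_Integration.integral_nonneg) (simp add: W_def)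
  have Xm: "X \<in> borel_measurable P" by (rule gaussian_matrix_measurable) fact
  have "(\<integral>\<^sup>+\<omega>. ennreal (exp (\<theta> * rho \<Sigma> (X \<omega>))) \<partial>P)
      = ennreal ((1 - 2 * \<theta>) powr (- \<nu> / 2)) * (\<integral>\<^sup>+\<omega>. ennreal (W (U \<omega>)) \<partial>P)"
    unfolding \<nu> l_def U_def W_def
    by (rule mgf_rho_eq_exp_moment_u_ratio[OF assms(1) q assms(3,4,5) \<theta>])
  also have "\<dots> = ennreal ((1 - 2 * \<theta>) powr (- \<nu> / 2) * I)"
    using EU I0 by (subst nn_integral_eq_integral) (auto simp: ennreal_mult W_def)
  finally have "integrable P (\<lambda>\<omega>. exp (\<theta> * rho \<Sigma> (X \<omega>))) \<and>
      (\<integral>\<omega>. exp (\<theta> * rho \<Sigma> (X \<omega>)) \<partial>P) = (1 - 2 * \<theta>) powr (- \<nu> / 2) * I"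
    using I0 measurable_compose[OF Xm measurable_rho, of \<Sigma>]
    by (subst (asm) nn_integral_eq_integrable) auto
  then show "integrable P (\<lambda>\<omega>. exp (\<theta> * rho \<Sigma> (X \<omega>))) \<and>
           summable (\<lambda>k. (1 / (1 - 2 * \<theta>)) ^ k * mix_weight (noncentrality M \<Sigma>) h k) \<and>
           mgf P (\<lambda>\<omega>. rho \<Sigma> (X \<omega>)) \<theta> =
             (1 - 2 * \<theta>) powr (- \<nu> / 2) *
             pgf (mix_weight (noncentrality M \<Sigma>) h) (1 / (1 - 2 * \<theta>))"
    using moments(2) by (simp add: mgf_def pgf_def sums_iff s_def[symmetric] l_def[symmetric])
qed

end
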